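(* Let $M$ be a smooth finite-dimensional manifold, let $F:W\to\Gamma(TM)$, $w\mapsto F_w$, be a linear map into smooth vector fields on $M$, and let $\bar y_0\in M$. There exists a local in time solution to the rough differential equation $d\mathbf y_t=F_{d\mathbf X_t}(y_t)$ with initial condition $y_0=\bar y_0$; that is, there are $\tau\in(0,T]$ and a solution $\mathbf y=(y,y^\dagger)$ on $[0,\tau]$ with $y_0=\bar y_0$.
   Context: Rough paths. $W=\mathbb R^k$, $T>0$, $1\le p<3$, $\Delta_{[0,T]}=\{(s,t):0\le s\le t\le T\}$. A control is a continuous $\omega:\Delta_{[0,T]}\to[0,\infty)$ with $\omega(s,s)=0$ and $\omega(s,t)+\omega(t,u)\le\omega(s,u)$ for $s\le t\le u$. $\mathbf X=(x,\mathbb X)$ is a fixed weak-geometric $p$-rough path with control $\omega$: $x:[0,T]\to W$ and $\mathbb X:\Delta_{[0,T]}\to W\otimes W$ are continuous and, with $x_{s,t}:=x_t-x_s$, one has $\mathbb X_{s,u}=\mathbb X_{s,t}+\mathbb X_{t,u}+x_{s,t}\otimes x_{t,u}$ for $s\le t\le u$, $|x_{s,t}|\le\omega(s,t)^{1/p}$, $|\mathbb X_{s,t}|\le\omega(s,t)^{2/p}$, and the symmetric part of $\mathbb X_{s,t}$ equals $\frac12x_{s,t}\otimes x_{s,t}$. Notation $|_{w\otimes\tilde w=\mathbb W}$: for a bilinear $\Xi$ on $W\times W$ and $\mathbb W=\sum_iw_i\otimes\tilde w_i$, $\Xi(w,\tilde w)|_{w\otimes\tilde w=\mathbb W}:=\sum_i\Xi(w_i,\tilde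 w_i)$. Solution: a pair $\mathbf y=(y,y^\dagger)$ of continuous functions on an interval $I_0$ (of the form $[0,T_0]$ or $[0,T_0)$, $T_0\le T$), with $y_s\in M$ and $y_s^\dagger\in L(W,T_{y_s}M)$, solves $d\mathbf y_t=F_{d\mathbf X_t}(y_t)$ if $y_s^\dagger w=F_w(y_s)$ for all $s\in I_0$, $w\in W$, and for every $f\in C^\infty(M)$ and every $[a,b]\subseteq I_0$ there are $C<\infty$, $\delta>0$ with $$\left|f(y_t)-f(y_s)-(F_{x_{s,t}}f)(y_s)-(F_wF_{\tilde w}f)(y_s)|_{w\otimes\tilde w=\mathbb X_{s,t}}\right|\le C\omega(s,t)^{3/p}$$ for all $a\le s\le t\le b$ with $t-s\le\delta$ (vector fields acting as first-order differential operators). *)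

theory Defs
  imports "HOL-Analysis.Analysis"
begin

section \<open>Smooth manifolds\<close>

text \<open>
  \<open>Ck_on k S f\<close> is meant for open \<open>S\<close> in a finite-dimensional normed space: \<open>f\<close> is \<open>k\<close> times
  continuously differentiable on \<open>S\<close>. The differentiability clause is total differentiability, and
  the directional derivatives \<open>x \<mapsto> Df(x) v\<close> are required to be of class \<open>C\<^sup>k\<close> in turn.
\<close>
primrec Ck_on ::
  "nat \<Rightarrow> 'a::real_normed_vector set \<Rightarrow> ('a \<Rightarrow> 'b::real_normed_vector) \<Rightarrow> bool" where
  "Ck_on 0 S f \<longleftrightarrow> continuous_on S f"
| "Ck_on (Suc k) S f \<longleftrightarrow>
     (\<forall>x\<in>S. f differentiable (at x)) \<and>
     (\<forall>v. Ck_on k S (\<lambda>x. frechet_derivative f (at x) v))"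

definition smooth_on ::
  "'a::real_normed_vector set \<Rightarrow> ('a \<Rightarrow> 'b::real_normed_vector) \<Rightarrow> bool" where
  "smooth_on S f \<longleftrightarrow> (\<forall>k. Ck_on k S f)"

text \<open>
  A chart is a pair \<open>(U, \<phi>)\<close>; only the restriction of \<open>\<phi>\<close> to \<open>U\<close> matters, and the inverse chart is
  \<open>inv_into U \<phi>\<close>.
\<close>
type_synonym ('m, 'e) chart = "'m set \<times> ('m \<Rightarrow> 'e)"

definition is_chart :: "'m topology \<Rightarrow> ('m, 'e::real_normed_vector) chart \<Rightarrow> bool" where
  "is_chart M = (\<lambda>(U, \<phi>). openin M U \<and> open (\<phi> ` U) \<and>
     homeomorphic_map (subtopology M U) (top_of_set (\<phi> ` U)) \<phi>)"

text \<open>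
  The manifold is the topological space \<open>M\<close> with an atlas \<open>A\<close> (not necessarily maximal: all notions
  below depend only on the smooth structure generated by \<open>A\<close>). The model space \<open>'e\<close> is an arbitrary
  finite-dimensional real normed space rather than a type of class \<^class>\<open>euclidean_space\<close>, so that
  zero-dimensional manifolds are included.
\<close>
definition smooth_manifold ::
  "'m topology \<Rightarrow> ('m, 'e::real_normed_vector) chart set \<Rightarrow> bool" where
  "smooth_manifold M A \<longleftrightarrow>
     (\<exists>B::'e set. finite B \<and> span B = UNIV) \<and>
     Hausdorff_space M \<and> second_countable M \<and>
     (\<forall>c\<in>A. is_chart M c) \<and>
     (\<Union>(U, \<phi>)\<in>A. U) = topspace M \<and>
     (\<forall>(U, \<phi>)\<in>A. \<forall>(V, \<psi>)\<in>A. smooth_on (\<phi> ` (U \<inter> V)) (\<psi> \<circ> inv_into U \<phi>))"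

definition smooth_functions ::
  "('m, 'e::real_normed_vector) chart set \<Rightarrow> ('m \<Rightarrow> real) set" where
  "smooth_functions A = {f. \<forall>(U, \<phi>)\<in>A. smooth_on (\<phi> ` U) (f \<circ> inv_into U \<phi>)}"

text \<open>
  Tangent vectors at \<open>q\<close> are the derivations at \<open>q\<close> of the algebra of smooth functions. The last
  clause fixes the irrelevant values on non-smooth functions, so that equality of tangent vectors is
  equality in HOL.
\<close>
type_synonym 'm tangent_vector = "('m \<Rightarrow> real) \<Rightarrow> real"

definition tangent_space ::
  "('m, 'e::real_normed_vector) chart set \<Rightarrow> 'm \<Rightarrow> 'm tangent_vector set" where
  "tangent_space A q = {v.
     (\<forall>f\<in>smooth_functions A. \<forall>g\<in>smooth_functions A.
        v (\<lambda>m. f m + g m) = v f + v g \<and>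
        v (\<lambda>m. f m * g m) = f q * v g + g q * v f) \<and>
     (\<forall>f\<in>smooth_functions A. \<forall>c. v (\<lambda>m. c * f m) = c * v f) \<and>
     (\<forall>f. f \<notin> smooth_functions A \<longrightarrow> v f = 0)}"

text \<open>The linear maps from \<open>W\<close> to the tangent space at \<open>q\<close>; vector operations on tangent vectors are
  pointwise.\<close>
definition linear_maps_tangent ::
  "('m, 'e::real_normed_vector) chart set \<Rightarrow> 'm \<Rightarrow> ('w::real_vector \<Rightarrow> 'm tangent_vector) set" where
  "linear_maps_tangent A q =
     {L. (\<forall>w. L w \<in> tangent_space A q) \<and> (\<forall>f. linear (\<lambda>w. L w f))}"

text \<open>
  \<open>chart_vector c q e\<close> is \<open>\<Sum>\<^sub>i e\<^sub>i \<partial>/\<partial>\<phi>\<^sub>i\<close> at \<open>q\<close>, acting on functions, for the chart \<open>c = (U, \<phi>)\<close>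
  and \<open>q \<in> U\<close>.
\<close>
definition chart_vector ::
  "('m, 'e::real_normed_vector) chart \<Rightarrow> 'm \<Rightarrow> 'e \<Rightarrow> 'm tangent_vector" where
  "chart_vector = (\<lambda>(U, \<phi>) q e f. frechet_derivative (f \<circ> inv_into U \<phi>) (at (\<phi> q)) e)"

text \<open>
  Smooth sections of the tangent bundle: in every chart \<open>(U, \<phi>)\<close> the field is
  \<open>\<Sum>\<^sub>i \<xi>\<^sub>i(\<phi>(q)) \<partial>/\<partial>\<phi>\<^sub>i\<close> with a smooth coefficient function \<open>\<xi>\<close>.
\<close>
definition smooth_vector_fields ::
  "'m topology \<Rightarrow> ('m, 'e::real_normed_vector) chart set \<Rightarrow> ('m \<Rightarrow> 'm tangent_vector) set" where
  "smooth_vector_fields M A = {X.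
     (\<forall>q\<in>topspace M. X q \<in> tangent_space A q) \<and>
     (\<forall>(U, \<phi>)\<in>A. \<exists>\<xi>. smooth_on (\<phi> ` U) \<xi> \<and>
        (\<forall>q\<in>U. \<forall>f\<in>smooth_functions A. X q f = chart_vector (U, \<phi>) q (\<xi> (\<phi> q)) f))}"

definition apply_field :: "('m \<Rightarrow> 'm tangent_vector) \<Rightarrow> ('m \<Rightarrow> real) \<Rightarrow> 'm \<Rightarrow> real" where
  "apply_field X f = (\<lambda>q. X q f)"

definition linear_into_fields ::
  "'m topology \<Rightarrow> ('m, 'e::real_normed_vector) chart set \<Rightarrow>
   ('w::real_vector \<Rightarrow> 'm \<Rightarrow> 'm tangent_vector) \<Rightarrow> bool" where
  "linear_into_fields M A F \<longleftrightarrow>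
     (\<forall>w. F w \<in> smooth_vector_fields M A) \<and>
     (\<forall>q\<in>topspace M. \<forall>f. linear (\<lambda>w. F w q f))"

section \<open>Rough paths\<close>

definition simplex2 :: "real \<Rightarrow> (real \<times> real) set" where
  "simplex2 T = {(s, t). 0 \<le> s \<and> s \<le> t \<and> t \<le> T}"

definition control :: "real \<Rightarrow> (real \<Rightarrow> real \<Rightarrow> real) \<Rightarrow> bool" where
  "control T \<omega> \<longleftrightarrow>
     continuous_on (simplex2 T) (\<lambda>(s, t). \<omega> s t) \<and>
     (\<forall>s t. 0 \<le> s \<and> s \<le> t \<and> t \<le> T \<longrightarrow> 0 \<le> \<omega> s t) \<and>
     (\<forall>s. 0 \<le> s \<and> s \<le> T \<longrightarrow> \<omega> s s = 0) \<and>
     (\<forall>s t u. 0 \<le> s \<and> s \<le> t \<and> t \<le> u \<and> u \<le> T \<longrightarrow> \<omega> s t + \<omega> t u \<le> \<omega> s u)"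

text \<open>
  The tensor square of \<open>\<real>\<^sup>k\<close> is the space of \<open>k \<times> k\<close> matrices; its norm is the Frobenius norm.
\<close>
definition tensor :: "real^'k \<Rightarrow> real^'k \<Rightarrow> real^'k^'k" where
  "tensor u v = (\<chi> i j. u $ i * v $ j)"

text \<open>
  \<open>contract \<Xi> \<W>\<close> is the value of the bilinear map \<open>\<Xi>\<close> on the tensor \<open>\<W>\<close>, computed from the expansion
  of \<open>\<W>\<close> in the standard basis; the lemma below shows that every other representation of \<open>\<W>\<close> as a
  sum of elementary tensors gives the same value.
\<close>
definition contract :: "(real^'k \<Rightarrow> real^'k \<Rightarrow> real) \<Rightarrow> real^'k^'k \<Rightarrow> real" where
  "contract \<Xi> \<W> = (\<Sum>i\<in>UNIV. \<Sum>j\<in>UNIV. \<W> $ i $ j * \<Xi> (axis i 1) (axis j 1))"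

lemma contract_sum_tensor:
  fixes \<Xi> :: "real^'k \<Rightarrow> real^'k \<Rightarrow> real"
  assumes "bilinear \<Xi>"
  shows "contract \<Xi> (\<Sum>n\<in>I. tensor (u n) (v n)) = (\<Sum>n\<in>I. \<Xi> (u n) (v n))"
proof -
  have expand: "\<Xi> a b = (\<Sum>i\<in>UNIV. \<Sum>j\<in>UNIV. (a $ i * b $ j) * \<Xi> (axis i 1) (axis j 1))" for a b
  proof -
    have *: "z = (\<Sum>i\<in>UNIV. z $ i *\<^sub>R axis i 1)" for z :: "real^'k"
      using basis_expansion[of z] by (simp add: scalar_mult_eq_scaleR)
    have "\<Xi> a b = \<Xi> (\<Sum>i\<in>UNIV. a $ i *\<^sub>R axis i 1) (\<Sum>j\<in>UNIV. b $ j *\<^sub>R axis j 1)"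
      using *[of a] *[of b] by simp
    also have "\<dots> = (\<Sum>(i, j)\<in>UNIV \<times> UNIV. \<Xi> (a $ i *\<^sub>R axis i 1) (b $ j *\<^sub>R axis j 1))"
      by (rule bilinear_sum[OF assms])
    also have "\<dots> = (\<Sum>i\<in>UNIV. \<Sum>j\<in>UNIV. (a $ i * b $ j) * \<Xi> (axis i 1) (axis j 1))"
      unfolding sum.cartesian_product
      by (intro sum.cong)
         (auto simp: bilinear_lmul[OF assms] bilinear_rmul[OF assms])
    finally show ?thesis .
  qed
  have "contract \<Xi> (\<Sum>n\<in>I. tensor (u n) (v n)) =
      (\<Sum>i\<in>UNIV. \<Sum>j\<in>UNIV. \<Sum>n\<in>I. (u n $ i * v n $ j) * \<Xi> (axis i 1) (axis j 1))"
    by (simp add: contract_def tensor_def sum_distrib_right)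
  also have "\<dots> = (\<Sum>i\<in>UNIV. \<Sum>n\<in>I. \<Sum>j\<in>UNIV. (u n $ i * v n $ j) * \<Xi> (axis i 1) (axis j 1))"
    by (intro sum.cong refl sum.swap)
  also have "\<dots> = (\<Sum>n\<in>I. \<Sum>i\<in>UNIV. \<Sum>j\<in>UNIV. (u n $ i * v n $ j) * \<Xi> (axis i 1) (axis j 1))"
    by (rule sum.swap)
  finally show ?thesis
    by (simp add: expand[symmetric])
qed

definition weak_geometric_rough_path ::
  "real \<Rightarrow> real \<Rightarrow> (real \<Rightarrow> real \<Rightarrow> real) \<Rightarrow> (real \<Rightarrow> real^'k) \<Rightarrow> (real \<Rightarrow> real \<Rightarrow> real^'k^'k) \<Rightarrow> bool"
where
  "weak_geometric_rough_path T p \<omega> x \<X> \<longleftrightarrow>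
     continuous_on {0..T} x \<and>
     continuous_on (simplex2 T) (\<lambda>(s, t). \<X> s t) \<and>
     (\<forall>s t u. 0 \<le> s \<and> s \<le> t \<and> t \<le> u \<and> u \<le> T \<longrightarrow>
        \<X> s u = \<X> s t + \<X> t u + tensor (x t - x s) (x u - x t)) \<and>
     (\<forall>s t. 0 \<le> s \<and> s \<le> t \<and> t \<le> T \<longrightarrow>
        norm (x t - x s) \<le> \<omega> s t powr (1 / p) \<and>
        norm (\<X> s t) \<le> \<omega> s t powr (2 / p) \<and>
        (1/2) *\<^sub>R (\<X> s t + transpose (\<X> s t)) = (1/2) *\<^sub>R tensor (x t - x s) (x t - x s))"

section \<open>Rough differential equations\<close>

text \<open>
  Continuity of \<open>s \<mapsto> y\<^sup>\<dagger>\<^sub>s\<close> as a map into the vector bundle \<open>L(W, TM)\<close> over a continuous base path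
  \<open>y\<close>, expressed in the local trivializations of the bundle given by the charts.
\<close>
definition continuous_along ::
  "('m, 'e::real_normed_vector) chart set \<Rightarrow> real set \<Rightarrow> (real \<Rightarrow> 'm) \<Rightarrow>
   (real \<Rightarrow> 'w::real_normed_vector \<Rightarrow> 'm tangent_vector) \<Rightarrow> bool" where
  "continuous_along A I0 y y' \<longleftrightarrow>
     (\<forall>(U, \<phi>)\<in>A. \<exists>\<eta>::real \<Rightarrow> 'w \<Rightarrow>\<^sub>L 'e.
        continuous_on {s\<in>I0. y s \<in> U} \<eta> \<and>
        (\<forall>s\<in>I0. y s \<in> U \<longrightarrow> (\<forall>w. \<forall>f\<in>smooth_functions A.
           y' s w f = chart_vector (U, \<phi>) (y s) (blinfun_apply (\<eta> s) w) f)))"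

definition rde_solution ::
  "'m topology \<Rightarrow> ('m, 'e::real_normed_vector) chart set \<Rightarrow> (real^'k \<Rightarrow> 'm \<Rightarrow> 'm tangent_vector) \<Rightarrow>
   real \<Rightarrow> real \<Rightarrow> (real \<Rightarrow> real \<Rightarrow> real) \<Rightarrow> (real \<Rightarrow> real^'k) \<Rightarrow> (real \<Rightarrow> real \<Rightarrow> real^'k^'k) \<Rightarrow>
   real set \<Rightarrow> (real \<Rightarrow> 'm) \<Rightarrow> (real \<Rightarrow> real^'k \<Rightarrow> 'm tangent_vector) \<Rightarrow> bool"
where
  "rde_solution M A F T p \<omega> x \<X> I0 y y' \<longleftrightarrow>
     (\<exists>T0. 0 \<le> T0 \<and> T0 \<le> T \<and> (I0 = {0..T0} \<or> I0 = {0..<T0})) \<and>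
     continuous_map (top_of_set I0) M y \<and>
     (\<forall>s\<in>I0. y' s \<in> linear_maps_tangent A (y s)) \<and>
     continuous_along A I0 y y' \<and>
     (\<forall>s\<in>I0. \<forall>w. y' s w = F w (y s)) \<and>
     (\<forall>f\<in>smooth_functions A. \<forall>a b. a \<le> b \<and> {a..b} \<subseteq> I0 \<longrightarrow>
        (\<exists>C \<delta>. 0 < \<delta> \<and> (\<forall>s t. a \<le> s \<and> s \<le> t \<and> t \<le> b \<and> t - s \<le> \<delta> \<longrightarrow>
           \<bar>f (y t) - f (y s) - apply_field (F (x t - x s)) f (y s)
              - contract (\<lambda>w w'. apply_field (F w) (apply_field (F w') f) (y s)) (\<X> s t)\<bar>
             \<le> C * \<omega> s t powr (3 / p))))"

end

theory Submission
  imports Defs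
begin

text \<open>
  In a chart around the initial point the equation becomes a rough differential equation on a compact
  ball of a finite-dimensional space. Following Davie, an Euler scheme whose step from \<open>s\<close> to \<open>t\<close> is
  \<open>\<mu>(z; s, t) = \<xi>(z) x\<^sub>s\<^sub>t + (D\<xi> \<xi>)(z) \<X>\<^sub>s\<^sub>t\<close> satisfies
  \<open>\<bar>z\<^sub>t - z\<^sub>s - \<mu>(z\<^sub>s; s, t)\<bar> \<le> L \<omega>(s, t)\<^sup>3\<^sup>/\<^sup>p\<close> for all pairs of its grid points, with \<open>L\<close> independent of the
  grid, because by Chen's relation \<open>\<mu>\<close> is additive up to an error of order \<open>\<omega>\<^sup>3\<^sup>/\<^sup>p\<close> and \<open>3/p > 1\<close>. For
  each pair \<open>(s, t)\<close> this estimate is a closed condition on \<open>z\<close>, and any finite family of these conditions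
  is met by an Euler scheme; compactness of the product space of all paths in the ball therefore yields
  a path that meets all of them at once. A third order Taylor expansion of the test function turns the
  estimate into the defining property of a solution: the part of \<open>\<X>\<close> that meets the symmetric second
  derivative is its symmetric part, which weak geometricity fixes as \<open>x \<otimes> x / 2\<close>.
\<close>

section \<open>Finite-dimensional normed spaces\<close>

text \<open>The obstacle is a circularity: the additivity defect of the Euler step can be estimated
  only at points of the ball, and only when the intermediate point is already close to the Euler
  step from the earlier one; yet both facts are consequences of the estimate to be proved. Two
  nested inductions over grid indices resolve it, one on the length of an index interval, one on the
  last index. The constant \<open>L\<close> is fixed first, by
  \<open>2 * C + 2 powr (1 - 3 / p) * L \<le> L\<close>, which is solvable because p < 3; only then
  is \<tau> taken small in terms of \<open>L\<close> and the radius. Compactness is applied to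
  arbitrary functions of time; continuity of the limit is read off from the estimate afterwards. The
  model space carries only a norm and a finite spanning set, so Heine-Borel, bounded coordinates and
  the symmetry of second derivatives are derived from these. Coordinates have a second task:
  \<open>Ck_on\<close> speaks of derivatives in fixed directions, and expansion in a basis transfers
  its content to directions that vary with the point.\<close>

lemma closed_subspace_scaleR_bound:
  fixes b :: "'a::real_normed_vector"
  assumes "closed V" "subspace V" "b \<notin> V"
  obtains d where "0 < d" "\<And>a v. v \<in> V \<Longrightarrow> \<bar>a\<bar> * d \<le> norm (a *\<^sub>R b + v)"
proof
  \<comment> \<open>The constant is the distance from \<open>b\<close> to \<open>V\<close>, positive
    because \<open>V\<close> is closed; for nonzero a, the vector a b + v is a times the difference
    of \<open>b\<close> and a point of \<open>V\<close>.\<close>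
  show pos: "0 < infdist b V"
    using assms by (intro infdist_pos_not_in_closed) (auto dest: subspace_0)
  fix a v assume v: "v \<in> V"
  show "\<bar>a\<bar> * infdist b V \<le> norm (a *\<^sub>R b + v)"
  proof (cases "a = 0")
    case False
    have "(- inverse a) *\<^sub>R v \<in> V" using v assms(2) by (rule subspace_scale[rotated])
    then have "infdist b V \<le> dist b ((- inverse a) *\<^sub>R v)" by (rule infdist_le)
    also have "\<dots> = norm (b + inverse a *\<^sub>R v)" by (simp add: dist_norm)
    finally have "\<bar>a\<bar> * infdist b V \<le> \<bar>a\<bar> * norm (b + inverse a *\<^sub>R v)"
      by (intro mult_left_mono) auto
    also have "\<dots> = norm (a *\<^sub>R (b + inverse a *\<^sub>R v))" by simp
    also have "\<dots> = norm (a *\<^sub>R b + v)" using False by (simp add: scaleR_add_right)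
    finally show ?thesis .
  qed simp
qed

text \<open>A convergent sequence is bounded, so it lies in one of the compact pieces, which
  contains its limit.\<close>

lemma closed_if_compact_Int_cball:
  fixes V :: "'a::real_normed_vector set"
  assumes "\<And>R. compact (cball 0 R \<inter> V)"
  shows "closed V"
proof (unfold closed_sequential_limits, intro allI impI)
  fix x l assume x: "(\<forall>n. x n \<in> V) \<and> x \<longlonglongrightarrow> l"
  then have "Bseq x" by (auto intro: convergent_imp_Bseq convergentI)
  then obtain R where "\<And>n. norm (x n) \<le> R" by (auto simp: Bseq_def)
  with x have "\<forall>n. x n \<in> cball 0 R \<inter> V" by auto
  with x assms[of R] show "l \<in> V"
    by (meson IntE closed_sequentially compact_imp_closed)
qed

text \<open>Heine-Borel by induction on the spanning set. The induction hypothesis makes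
  \<open>span B\<close> closed, so a vector \<open>b\<close> outside it has positive distance from
  it; this bounds the coefficient of \<open>b\<close> on a ball and places the ball inside the image
  of a compact product.\<close>

lemma compact_cball_Int_span:
  fixes B :: "'a::real_normed_vector set"
  assumes "finite B"
  shows "compact (cball 0 R \<inter> span B)"
  using assms
proof (induction B arbitrary: R rule: finite_induct)
  case empty
  show ?case by (simp add: finite_imp_compact)
next
  case (insert b B)
  show ?case
  proof (cases "b \<in> span B")
    case True
    then show ?thesis using insert.IH by (simp add: span_redundant)
  next
    case False
    have "closed (span B)" by (rule closed_if_compact_Int_cball) (rule insert.IH)
    from closed_subspace_scaleR_bound[OF this subspace_span False]
    obtain d where d: "0 < d" "\<And>a v. v \<in> span B \<Longrightarrow> \<bar>a\<bar> * d \<le> norm (a *\<^sub>R b + v)" by blast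
    \<comment> \<open>\<open>R / d\<close> bounds the coefficient of \<open>b\<close>;
      \<open>R'\<close> then bounds what is left after that multiple of \<open>b\<close> is
      removed.\<close>
    define R' where "R' = R + R / d * norm b"
    define K where "K = (\<lambda>(a, v). a *\<^sub>R b + v) ` ({-R/d..R/d} \<times> (cball 0 R' \<inter> span B))"
    have "compact K" unfolding K_def
      by (intro compact_continuous_image compact_Times insert.IH)
         (auto intro!: continuous_intros simp: case_prod_unfold)
    moreover have "cball 0 R \<inter> span (insert b B) = cball 0 R \<inter> K"
    proof (intro equalityI subsetI)
      fix z assume z: "z \<in> cball 0 R \<inter> span (insert b B)"
      then obtain a where "z - a *\<^sub>R b \<in> span B" by (auto simp: span_insert)
      then obtain v where v: "v \<in> span B" "z = a *\<^sub>R b + v"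
        by (metis add.commute diff_add_cancel)
      have "\<bar>a\<bar> * d \<le> R" using d(2)[OF v(1), of a] z v by auto
      then have a: "\<bar>a\<bar> \<le> R / d" using d(1) by (simp add: field_simps)
      have "norm v = norm (z - a *\<^sub>R b)" using v by simp
      also have "\<dots> \<le> norm z + \<bar>a\<bar> * norm b" by (metis norm_scaleR norm_triangle_ineq4)
      also have "\<dots> \<le> R'" unfolding R'_def using z a by (intro add_mono mult_right_mono) auto
      finally have "(a, v) \<in> {-R/d..R/d} \<times> (cball 0 R' \<inter> span B)" using v a by auto
      then have "z \<in> K" unfolding K_def by (rule image_eqI[rotated]) (simp add: v(2))
      then show "z \<in> cball 0 R \<inter> K" using z by simp
    next
      fix z assume z: "z \<in> cball 0 R \<inter> K"
      moreover have "span B \<subseteq> span (insert b B)" by (rule span_mono) auto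
      ultimately show "z \<in> cball 0 R \<inter> span (insert b B)"
        by (auto simp: K_def intro!: span_add span_scale[of b] intro: span_base)
    qed
    ultimately show ?thesis by (simp add: closed_Int_compact)
  qed
qed

text \<open>Coordinate functionals stand in for the inner product of a Euclidean space. An empty
  \<open>B\<close> is allowed, which covers dimension zero.\<close>

locale finite_coordinates =
  fixes B :: "'e::real_normed_vector set" and c :: "'e \<Rightarrow> 'e \<Rightarrow> real"
  assumes finite_B: "finite B"
    and bounded_linear_coord: "b \<in> B \<Longrightarrow> bounded_linear (c b)"
    and expansion: "v = (\<Sum>b\<in>B. c b v *\<^sub>R b)"

text \<open>A coordinate functional is bounded because its value at v, times the distance from
  \<open>b\<close> to the span of the other basis vectors, is at most the norm of v.\<close>

lemma finite_coordinates_exist: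
  fixes B0 :: "'e::real_normed_vector set"
  assumes "finite B0" "span B0 = UNIV"
  obtains B and c :: "'e \<Rightarrow> 'e \<Rightarrow> real" where "finite_coordinates B c"
proof -
  obtain B where B: "B \<subseteq> B0" "independent B" "B0 \<subseteq> span B"
    using maximal_independent_subset by metis
  have fB: "finite B" using B(1) assms(1) by (rule finite_subset)
  have sB: "span B = UNIV"
    using B(3) assms(2) by (metis span_mono span_span top.extremum_uniqueI)
  define c where "c b v = representation B v b" for b v
  have expand: "v = (\<Sum>b\<in>B. c b v *\<^sub>R b)" for v
    unfolding c_def using B(2) fB sB by (simp add: sum_representation_eq)
  have "bounded_linear (c b)" if b: "b \<in> B" for b
  proof -
    have "closed (span (B - {b}))"
      using fB by (intro closed_if_compact_Int_cball compact_cball_Int_span) auto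
    moreover have "b \<notin> span (B - {b})" using B(2) b by (auto simp: dependent_def)
    ultimately obtain d where
      d: "0 < d" "\<And>a v. v \<in> span (B - {b}) \<Longrightarrow> \<bar>a\<bar> * d \<le> norm (a *\<^sub>R b + v)"
      using closed_subspace_scaleR_bound[OF _ subspace_span] by metis
    show ?thesis
    proof (rule bounded_linear_intro[where K = "1 / d"])
      fix v w r
      show "c b (v + w) = c b v + c b w" unfolding c_def
        using B(2) sB by (simp add: representation_add)
      show "c b (r *\<^sub>R v) = r *\<^sub>R c b v" unfolding c_def
        using B(2) sB by (simp add: representation_scale)
      have "(\<Sum>a\<in>B - {b}. c a v *\<^sub>R a) \<in> span (B - {b})"
        by (intro span_sum span_scale span_base) auto
      from d(2)[OF this, of "c b v"] have "\<bar>c b v\<bar> * d \<le> norm v"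
        using expand[of v] by (simp add: sum.remove[OF fB b])
      then show "norm (c b v) \<le> norm v * (1 / d)" using d(1) by (simp add: field_simps)
    qed
  qed
  with fB expand have "finite_coordinates B c" by (simp add: finite_coordinates_def)
  then show ?thesis by (rule that)
qed

section \<open>Calculus of smooth functions\<close>

lemma Ck_on_cong:
  assumes "open S"
  shows "(\<And>x. x \<in> S \<Longrightarrow> f x = g x) \<Longrightarrow> Ck_on k S f \<Longrightarrow> Ck_on k S g"
proof (induction k arbitrary: f g)
  case 0
  then show ?case using continuous_on_cong by (metis Ck_on.simps(1))
next
  case (Suc k)
  have d: "f differentiable (at x)" if "x \<in> S" for x using Suc.prems that by simp
  have "g differentiable (at x)" if "x \<in> S" for x
    using d[OF that] Suc.prems(1) has_derivative_transform_within_open[of f _ x UNIV S g] assms that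
    unfolding differentiable_def by metis
  moreover have "Ck_on k S (\<lambda>x. frechet_derivative g (at x) v)" for v
  proof (rule Suc.IH)
    show "Ck_on k S (\<lambda>x. frechet_derivative f (at x) v)" using Suc.prems(2) by simp
    show "frechet_derivative f (at x) v = frechet_derivative g (at x) v" if "x \<in> S" for x
      using frechet_derivative_transform_within_open[OF d[OF that] assms that Suc.prems(1)] by simp
  qed
  ultimately show ?case by simp
qed

lemma Ck_on_Suc_imp: "Ck_on (Suc k) S f \<Longrightarrow> Ck_on k S f"
proof (induction k arbitrary: f)
  case 0
  then show ?case
    by (auto intro!: continuous_at_imp_continuous_on differentiable_imp_continuous_within)
next
  case (Suc k)
  then show ?case by (metis Ck_on.simps(2))
qed

lemma Ck_on_const: "Ck_on k S (\<lambda>_. a)"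
  by (induction k arbitrary: a) auto

lemma Ck_on_add:
  assumes "open S"
  shows "Ck_on k S f \<Longrightarrow> Ck_on k S g \<Longrightarrow> Ck_on k S (\<lambda>x. f x + g x)"
proof (induction k arbitrary: f g)
  case (Suc k)
  have "Ck_on k S (\<lambda>x. frechet_derivative (\<lambda>x. f x + g x) (at x) v)" for v
  proof (rule Ck_on_cong[OF assms _ Suc.IH])
    show "frechet_derivative f (at x) v + frechet_derivative g (at x) v =
        frechet_derivative (\<lambda>x. f x + g x) (at x) v" if "x \<in> S" for x
    proof -
      have "((\<lambda>x. f x + g x) has_derivative
          (\<lambda>v. frechet_derivative f (at x) v + frechet_derivative g (at x) v)) (at x)"
        using Suc.prems that by (intro has_derivative_add) (auto simp: frechet_derivative_works)
      from frechet_derivative_at[OF this, symmetric] show ?thesis by simp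
    qed
  qed (use Suc.prems in auto)
  then show ?case using Suc.prems by auto
qed (auto intro: continuous_on_add)

lemma Ck_on_sum:
  assumes "open S" "\<And>i. i \<in> I \<Longrightarrow> Ck_on k S (f i)"
  shows "Ck_on k S (\<lambda>x. \<Sum>i\<in>I. f i x)"
  using assms(2)
proof (induction I rule: infinite_finite_induct)
  case (insert i I)
  then show ?case by (auto intro!: Ck_on_add[OF assms(1)])
qed (auto intro: Ck_on_const)

lemma Ck_on_bounded_linear:
  assumes "open S" "bounded_linear h"
  shows "Ck_on k S f \<Longrightarrow> Ck_on k S (\<lambda>x. h (f x))"
proof (induction k arbitrary: f)
  case 0
  then show ?case using assms(2) by (auto intro: bounded_linear.continuous_on)
next
  case (Suc k)
  have der: "((\<lambda>x. h (f x)) has_derivative (\<lambda>v. h (frechet_derivative f (at x) v))) (at x)"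
    if "x \<in> S" for x
    using Suc.prems that
    by (intro bounded_linear.has_derivative[OF assms(2)]) (auto simp: frechet_derivative_works)
  have "Ck_on k S (\<lambda>x. frechet_derivative (\<lambda>x. h (f x)) (at x) v)" for v
  proof (rule Ck_on_cong[OF assms(1) _ Suc.IH])
    show "h (frechet_derivative f (at x) v) = frechet_derivative (\<lambda>x. h (f x)) (at x) v"
      if "x \<in> S" for x
      using frechet_derivative_at[OF der[OF that], symmetric] by simp
  qed (use Suc.prems in auto)
  then show ?case using der by (auto simp: differentiable_def)
qed

lemma Ck_on_scaleR:
  fixes f :: "'a::real_normed_vector \<Rightarrow> real" and g :: "'a \<Rightarrow> 'b::real_normed_vector"
  assumes "open S"
  shows "Ck_on k S f \<Longrightarrow> Ck_on k S g \<Longrightarrow> Ck_on k S (\<lambda>x. f x *\<^sub>R g x)"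
proof (induction k arbitrary: f g)
  case (Suc k)
  have der: "((\<lambda>x. f x *\<^sub>R g x) has_derivative (\<lambda>v. f x *\<^sub>R frechet_derivative g (at x) v +
      frechet_derivative f (at x) v *\<^sub>R g x)) (at x)" if "x \<in> S" for x
    using Suc.prems that by (intro has_derivative_scaleR) (auto simp: frechet_derivative_works)
  have "Ck_on k S (\<lambda>x. frechet_derivative (\<lambda>x. f x *\<^sub>R g x) (at x) v)" for v
  proof (rule Ck_on_cong[OF assms])
    \<comment> \<open>In each Leibniz term one factor is not differentiated; it enters with one
      order of smoothness less than it has.\<close>
    show "Ck_on k S (\<lambda>x. f x *\<^sub>R frechet_derivative g (at x) v + frechet_derivative f (at x) v *\<^sub>R g x)"
      using Suc.prems Ck_on_Suc_imp[OF Suc.prems(1)] Ck_on_Suc_imp[OF Suc.prems(2)]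
      by (intro Ck_on_add[OF assms] Suc.IH) auto
    show "f x *\<^sub>R frechet_derivative g (at x) v + frechet_derivative f (at x) v *\<^sub>R g x =
        frechet_derivative (\<lambda>x. f x *\<^sub>R g x) (at x) v" if "x \<in> S" for x
      using frechet_derivative_at[OF der[OF that], symmetric] by simp
  qed
  then show ?case using der by (auto simp: differentiable_def)
qed (auto intro: continuous_on_scaleR)

lemma smooth_on_cong: "open S \<Longrightarrow> (\<And>x. x \<in> S \<Longrightarrow> f x = g x) \<Longrightarrow> smooth_on S f \<Longrightarrow> smooth_on S g"
  unfolding smooth_on_def using Ck_on_cong by blast

lemma smooth_on_sum:
  "open S \<Longrightarrow> (\<And>i. i \<in> I \<Longrightarrow> smooth_on S (f i)) \<Longrightarrow> smooth_on S (\<lambda>x. \<Sum>i\<in>I. f i x)"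
  unfolding smooth_on_def by (auto intro: Ck_on_sum)

lemma smooth_on_bounded_linear:
  "open S \<Longrightarrow> bounded_linear h \<Longrightarrow> smooth_on S f \<Longrightarrow> smooth_on S (\<lambda>x. h (f x))"
  unfolding smooth_on_def by (auto intro: Ck_on_bounded_linear)

lemma smooth_on_scaleR:
  fixes f :: "'a::real_normed_vector \<Rightarrow> real"
  shows "open S \<Longrightarrow> smooth_on S f \<Longrightarrow> smooth_on S g \<Longrightarrow> smooth_on S (\<lambda>x. f x *\<^sub>R g x)"
  unfolding smooth_on_def by (auto intro: Ck_on_scaleR)

lemma smooth_on_const: "smooth_on S (\<lambda>_. a)"
  unfolding smooth_on_def by (auto intro: Ck_on_const)

lemma smooth_on_frechet_derivative:
  "smooth_on S f \<Longrightarrow> smooth_on S (\<lambda>x. frechet_derivative f (at x) v)"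
  unfolding smooth_on_def by (metis Ck_on.simps(2))

lemma smooth_on_has_derivative:
  "smooth_on S f \<Longrightarrow> x \<in> S \<Longrightarrow> (f has_derivative frechet_derivative f (at x)) (at x)"
  unfolding smooth_on_def by (metis Ck_on.simps(2) frechet_derivative_works)

lemma smooth_on_linear_derivative:
  "smooth_on S f \<Longrightarrow> x \<in> S \<Longrightarrow> linear (frechet_derivative f (at x))"
  using smooth_on_has_derivative has_derivative_linear by blast

lemma smooth_on_continuous_on: "smooth_on S f \<Longrightarrow> continuous_on S f"
  unfolding smooth_on_def by (metis Ck_on.simps(1))

text \<open>Keeping \<open>v\<close> fixed in the inner derivative fits the recursion of
  \<open>Ck_on\<close>. The outer direction \<open>u\<close> comes first; symmetry is proved later
  and is not built into the notation.\<close>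

abbreviation (input) second_derivative ::
  "('a::real_normed_vector \<Rightarrow> 'b::real_normed_vector) \<Rightarrow> 'a \<Rightarrow> 'a \<Rightarrow> 'a \<Rightarrow> 'b" where
  "second_derivative f x u v \<equiv>
     frechet_derivative (\<lambda>z. frechet_derivative f (at z) v) (at x) u"

section \<open>Derivatives along varying directions\<close>

context finite_coordinates
begin

lemma derivative_expansion:
  fixes f :: "'e \<Rightarrow> 'b::real_normed_vector"
  assumes "smooth_on S f" "x \<in> S"
  shows "frechet_derivative f (at x) v = (\<Sum>b\<in>B. c b v *\<^sub>R frechet_derivative f (at x) b)"
proof -
  have "frechet_derivative f (at x) (\<Sum>b\<in>B. c b v *\<^sub>R b) = (\<Sum>b\<in>B. c b v *\<^sub>R frechet_derivative f (at x) b)"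
    by (simp add: linear_sum[OF smooth_on_linear_derivative[OF assms]]
        linear_scale[OF smooth_on_linear_derivative[OF assms]])
  then show ?thesis by (simp only: expansion[of v, symmetric])
qed

text \<open>The definition of smoothness controls derivatives in constant directions only. The basis
  expansion writes the derivative along \<open>\<xi>\<close> as a finite sum of products of smooth
  functions.\<close>

lemma smooth_on_derivative_along:
  fixes f :: "'e \<Rightarrow> 'b::real_normed_vector"
  assumes "open S" "smooth_on S f" "smooth_on S \<xi>"
  shows "smooth_on S (\<lambda>x. frechet_derivative f (at x) (\<xi> x))"
proof (rule smooth_on_cong[OF assms(1)])
  show "smooth_on S (\<lambda>x. \<Sum>b\<in>B. c b (\<xi> x) *\<^sub>R frechet_derivative f (at x) b)"
    by (intro smooth_on_sum smooth_on_scaleR smooth_on_bounded_linear[of S "c _"] assms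
        bounded_linear_coord smooth_on_frechet_derivative)
qed (use derivative_expansion[OF assms(2)] in simp)

text \<open>A product rule. It yields the two parts of a composition of two vector fields: a second
  derivative, and a first derivative in the direction in which the inner field changes.\<close>

lemma derivative_derivative_along:
  fixes f :: "'e \<Rightarrow> 'b::real_normed_vector"
  assumes "open S" "smooth_on S f" "smooth_on S \<xi>" "x \<in> S"
  shows "frechet_derivative (\<lambda>z. frechet_derivative f (at z) (\<xi> z)) (at x) u =
    second_derivative f x u (\<xi> x) +
    frechet_derivative f (at x) (frechet_derivative \<xi> (at x) u)"
proof -
  let ?D = "\<lambda>b z. frechet_derivative f (at z) b"
  \<comment> \<open>Stated for a general field \<open>\<eta>\<close>: at \<open>\<xi>\<close> it
    computes the left-hand side, at the constant field with value \<open>\<xi> x\<close> it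
    identifies the second-derivative part.\<close>
  have D: "frechet_derivative (\<lambda>z. frechet_derivative f (at z) (\<eta> z)) (at x) u =
     (\<Sum>b\<in>B. c b (\<eta> x) *\<^sub>R frechet_derivative (?D b) (at x) u +
       c b (frechet_derivative \<eta> (at x) u) *\<^sub>R ?D b x)" if \<eta>: "smooth_on S \<eta>" for \<eta>
  proof -
    have "((\<lambda>z. \<Sum>b\<in>B. c b (\<eta> z) *\<^sub>R ?D b z) has_derivative
       (\<lambda>u. \<Sum>b\<in>B. c b (\<eta> x) *\<^sub>R frechet_derivative (?D b) (at x) u +
        c b (frechet_derivative \<eta> (at x) u) *\<^sub>R ?D b x)) (at x)"
      using assms \<eta>
      by (intro has_derivative_sum has_derivative_scaleR
          bounded_linear.has_derivative[OF bounded_linear_coord] smooth_on_has_derivative[of S]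
          smooth_on_frechet_derivative) auto
    then have "((\<lambda>z. frechet_derivative f (at z) (\<eta> z)) has_derivative
       (\<lambda>u. \<Sum>b\<in>B. c b (\<eta> x) *\<^sub>R frechet_derivative (?D b) (at x) u +
        c b (frechet_derivative \<eta> (at x) u) *\<^sub>R ?D b x)) (at x)"
      by (rule has_derivative_transform_within_open[OF _ assms(1,4)])
         (use derivative_expansion[OF assms(2)] in simp)
    from frechet_derivative_at[OF this, symmetric] show ?thesis by simp
  qed
  have "c b 0 = 0" if "b \<in> B" for b
    using linear_0[OF bounded_linear.linear[OF bounded_linear_coord[OF that]]] .
  then have D0: "second_derivative f x u (\<xi> x) =
      (\<Sum>b\<in>B. c b (\<xi> x) *\<^sub>R frechet_derivative (?D b) (at x) u)"
    using D[OF smooth_on_const[of S "\<xi> x"]] by simp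
  show ?thesis
    unfolding D[OF assms(3)] D0 derivative_expansion[OF assms(2,4), of "frechet_derivative \<xi> (at x) u"]
    by (rule sum.distrib)
qed

lemma second_derivative_expansion:
  fixes f :: "'e \<Rightarrow> 'b::real_normed_vector"
  assumes "open S" "smooth_on S f" "x \<in> S"
  shows "second_derivative f x u v = (\<Sum>b\<in>B. c b v *\<^sub>R second_derivative f x u b)"
proof -
  let ?D = "\<lambda>b z. frechet_derivative f (at z) b"
  have "((\<lambda>z. \<Sum>b\<in>B. c b v *\<^sub>R ?D b z) has_derivative
       (\<lambda>u. \<Sum>b\<in>B. c b v *\<^sub>R frechet_derivative (?D b) (at x) u)) (at x)"
    using assms
    by (intro has_derivative_sum has_derivative_scaleR_right smooth_on_has_derivative[of S]
        smooth_on_frechet_derivative) auto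
  then have "((\<lambda>z. frechet_derivative f (at z) v) has_derivative
       (\<lambda>u. \<Sum>b\<in>B. c b v *\<^sub>R frechet_derivative (?D b) (at x) u)) (at x)"
    by (rule has_derivative_transform_within_open[OF _ assms(1,3)])
       (use derivative_expansion[OF assms(2)] in simp)
  from frechet_derivative_at[OF this, symmetric] show ?thesis by simp
qed

lemma bilinear_second_derivative:
  fixes f :: "'e \<Rightarrow> 'b::real_normed_vector"
  assumes "open S" "smooth_on S f" "x \<in> S"
  shows "bilinear (second_derivative f x)"
  unfolding bilinear_def
proof (intro conjI allI)
  show "linear (\<lambda>u. second_derivative f x u v)" for v
    using smooth_on_linear_derivative[OF smooth_on_frechet_derivative[OF assms(2)] assms(3)] by simp
  show "linear (\<lambda>v. second_derivative f x u v)" for u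
  proof -
    have "linear (\<lambda>v. \<Sum>b\<in>B. c b v *\<^sub>R G b)" for G :: "'e \<Rightarrow> 'b"
    by (rule linearI)
       (simp_all add: linear_add[OF bounded_linear.linear[OF bounded_linear_coord]]
         linear_scale[OF bounded_linear.linear[OF bounded_linear_coord]]
         scaleR_add_left sum.distrib scaleR_sum_right)
    moreover have "(\<lambda>v. second_derivative f x u v) = (\<lambda>v. \<Sum>b\<in>B. c b v *\<^sub>R second_derivative f x u b)"
      by (rule ext) (rule second_derivative_expansion[OF assms])
    ultimately show ?thesis by (simp only:)
  qed
qed

text \<open>Carries a bound for the basis directions over to every direction \<open>v\<close>. The
  factor \<open>r\<close> keeps the constant independent of the points at which the terms
  \<open>g b\<close> are evaluated.\<close>

lemma coordinate_combination_bound: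
  fixes C :: "'e \<Rightarrow> real"
  assumes "\<And>b. b \<in> B \<Longrightarrow> 0 \<le> C b"
  obtains C' where "0 \<le> C'"
    "\<And>v r g. (\<And>b. b \<in> B \<Longrightarrow> norm (g b) \<le> C b * r) \<Longrightarrow>
       norm (\<Sum>b\<in>B. c b v *\<^sub>R (g b :: 'b::real_normed_vector)) \<le> C' * norm v * r"
proof
  have on: "0 \<le> onorm (c b)" if "b \<in> B" for b using onorm_pos_le[OF bounded_linear_coord[OF that]] .
  show "0 \<le> (\<Sum>b\<in>B. onorm (c b) * C b)" using on assms by (auto intro!: sum_nonneg)
  fix v r and g :: "'e \<Rightarrow> 'b" assume g: "\<And>b. b \<in> B \<Longrightarrow> norm (g b) \<le> C b * r"
  have "norm (\<Sum>b\<in>B. c b v *\<^sub>R g b) \<le> (\<Sum>b\<in>B. norm (c b v) * norm (g b))"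
    by (auto intro!: sum_norm_le)
  also have "\<dots> \<le> (\<Sum>b\<in>B. (onorm (c b) * norm v) * (C b * r))"
    using g on by (intro sum_mono mult_mono onorm bounded_linear_coord) auto
  finally show "norm (\<Sum>b\<in>B. c b v *\<^sub>R g b) \<le> (\<Sum>b\<in>B. onorm (c b) * C b) * norm v * r"
    by (simp add: sum_distrib_left sum_distrib_right mult_ac)
qed

text \<open>Continuity on a compact set bounds the derivatives in the finitely many basis
  directions, and the coordinates combine these into one operator bound.\<close>

lemma derivative_bound:
  fixes f :: "'e \<Rightarrow> 'b::real_normed_vector"
  assumes "smooth_on S f" "compact K" "K \<subseteq> S"
  obtains C where "0 \<le> C" "\<And>z v. z \<in> K \<Longrightarrow> norm (frechet_derivative f (at z) v) \<le> C * norm v"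
proof -
  have "\<exists>C\<ge>0. \<forall>z\<in>K. norm (frechet_derivative f (at z) b) \<le> C" for b
  proof -
    have "compact ((\<lambda>z. frechet_derivative f (at z) b) ` K)"
      using assms smooth_on_continuous_on[OF smooth_on_frechet_derivative[OF assms(1)]]
      by (intro compact_continuous_image) (auto intro: continuous_on_subset)
    then obtain C where "\<forall>w\<in>(\<lambda>z. frechet_derivative f (at z) b) ` K. norm w \<le> C"
      using compact_imp_bounded bounded_iff by blast
    then show ?thesis by (intro exI[of _ "max C 0"]) auto
  qed
  then obtain C where C: "\<And>b. 0 \<le> C b" "\<And>b z. z \<in> K \<Longrightarrow> norm (frechet_derivative f (at z) b) \<le> C b"
    by metis
  obtain C' where C': "0 \<le> C'"
    "\<And>v r g. (\<And>b. b \<in> B \<Longrightarrow> norm (g b) \<le> C b * r) \<Longrightarrow>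
       norm (\<Sum>b\<in>B. c b v *\<^sub>R (g b :: 'b)) \<le> C' * norm v * r"
    using coordinate_combination_bound[of C] C(1) by metis
  show ?thesis
  proof
    fix z v assume z: "z \<in> K"
    have "frechet_derivative f (at z) v = (\<Sum>b\<in>B. c b v *\<^sub>R frechet_derivative f (at z) b)"
      using z assms(3) by (intro derivative_expansion[OF assms(1)]) auto
    also have "norm \<dots> \<le> C' * norm v * 1" by (rule C'(2)) (use C(2)[OF z] in simp)
    finally show "norm (frechet_derivative f (at z) v) \<le> C' * norm v" by simp
  qed (rule C')
qed

section \<open>Mean value and Taylor estimates on compact convex sets\<close>

lemma lipschitz_bound:
  fixes f :: "'e \<Rightarrow> 'b::real_normed_vector"
  assumes "smooth_on S f" "compact K" "convex K" "K \<subseteq> S"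
  obtains C where "0 \<le> C" "\<And>x y. x \<in> K \<Longrightarrow> y \<in> K \<Longrightarrow> norm (f y - f x) \<le> C * norm (y - x)"
proof -
  obtain C where C: "0 \<le> C" "\<And>z v. z \<in> K \<Longrightarrow> norm (frechet_derivative f (at z) v) \<le> C * norm v"
    using derivative_bound[OF assms(1,2,4)] by blast
  show ?thesis
  proof
    fix x y assume "x \<in> K" "y \<in> K"
    then show "norm (f y - f x) \<le> C * norm (y - x)"
      using assms C
      by (intro differentiable_bound[of K f "\<lambda>z. frechet_derivative f (at z)"])
         (auto intro!: onorm_bound has_derivative_at_withinI smooth_on_has_derivative[OF assms(1)])
  qed (rule C)
qed

text \<open>Mean value inequality for f minus its derivative at x, on the segment from x to y: along
  it the derivative differs from that at x by at most a multiple of the length, since its basis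
  components are Lipschitz.\<close>

lemma taylor_bound_1:
  fixes f :: "'e \<Rightarrow> 'b::real_normed_vector"
  assumes "smooth_on S f" "compact K" "convex K" "K \<subseteq> S"
  obtains C where "0 \<le> C" "\<And>x y. x \<in> K \<Longrightarrow> y \<in> K \<Longrightarrow>
    norm (f y - f x - frechet_derivative f (at x) (y - x)) \<le> C * (norm (y - x))\<^sup>2"
proof -
  let ?D = "\<lambda>b z. frechet_derivative f (at z) b"
  have "\<exists>C\<ge>0. \<forall>x\<in>K. \<forall>y\<in>K. norm (?D b y - ?D b x) \<le> C * norm (y - x)" for b
    by (rule lipschitz_bound[OF smooth_on_frechet_derivative[OF assms(1), of b] assms(2-4)]) blast
  then obtain C where C: "\<And>b. 0 \<le> C b"
    "\<And>b x y. x \<in> K \<Longrightarrow> y \<in> K \<Longrightarrow> norm (?D b y - ?D b x) \<le> C b * norm (y - x)" by metis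
  obtain C' where C': "0 \<le> C'"
    "\<And>v r g. (\<And>b. b \<in> B \<Longrightarrow> norm (g b) \<le> C b * r) \<Longrightarrow>
       norm (\<Sum>b\<in>B. c b v *\<^sub>R (g b :: 'b)) \<le> C' * norm v * r"
    using coordinate_combination_bound[of C] C(1) by metis
  show ?thesis
  proof
    fix x y assume xy: "x \<in> K" "y \<in> K"
    have seg: "closed_segment x y \<subseteq> K" using xy assms(3) by (rule closed_segment_subset)
    have der: "(f has_derivative frechet_derivative f (at z)) (at z within T)" if "z \<in> K" for z T
      using that assms(4) by (auto intro!: has_derivative_at_withinI smooth_on_has_derivative[OF assms(1)])
    have bl: "bounded_linear (frechet_derivative f (at x))"
      using der[OF xy(1), of UNIV] has_derivative_bounded_linear by blast
    have "norm ((f y - frechet_derivative f (at x) y) - (f x - frechet_derivative f (at x) x))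
        \<le> (C' * norm (y - x)) * norm (y - x)"
    proof (rule differentiable_bound[of "closed_segment x y" "\<lambda>z. f z - frechet_derivative f (at x) z"
        "\<lambda>z v. frechet_derivative f (at z) v - frechet_derivative f (at x) v"])
      fix z assume z: "z \<in> closed_segment x y"
      with seg have zK: "z \<in> K" by auto
      show "((\<lambda>z. f z - frechet_derivative f (at x) z) has_derivative
          (\<lambda>v. frechet_derivative f (at z) v - frechet_derivative f (at x) v)) (at z within closed_segment x y)"
        by (intro has_derivative_diff der zK bounded_linear_imp_has_derivative bl)
      show "onorm (\<lambda>v. frechet_derivative f (at z) v - frechet_derivative f (at x) v) \<le> C' * norm (y - x)"
      proof (rule onorm_bound)
        fix v
        have "frechet_derivative f (at z) v - frechet_derivative f (at x) v =
            (\<Sum>b\<in>B. c b v *\<^sub>R (?D b z - ?D b x))"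
          using zK xy assms(4) derivative_expansion[OF assms(1), of _ v]
          by (auto simp: scaleR_diff_right sum_subtractf subset_iff)
        also have "norm \<dots> \<le> C' * norm v * norm (y - x)"
        proof (rule C'(2))
          fix b assume "b \<in> B"
          have "norm (?D b z - ?D b x) \<le> C b * norm (z - x)" using C zK xy by auto
          also have "\<dots> \<le> C b * norm (y - x)"
            using z C(1) segment_bound1[OF z] by (intro mult_left_mono) (auto simp: norm_minus_commute)
          finally show "norm (?D b z - ?D b x) \<le> C b * norm (y - x)" .
        qed
        finally show "norm (frechet_derivative f (at z) v - frechet_derivative f (at x) v) \<le>
            C' * norm (y - x) * norm v" by (simp add: mult_ac)
      qed (use C' in auto)
    qed auto
    moreover have "f y - f x - frechet_derivative f (at x) (y - x) =
        (f y - frechet_derivative f (at x) y) - (f x - frechet_derivative f (at x) x)"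
      by (simp add: linear_diff[OF bounded_linear.linear[OF bl]])
    ultimately show "norm (f y - f x - frechet_derivative f (at x) (y - x)) \<le> C' * (norm (y - x))\<^sup>2"
      by (simp only: power2_eq_square mult.assoc)
  qed (rule C')
qed

text \<open>The first-order estimate, applied to the derivatives in the basis directions, bounds the
  derivative of the remainder along the segment; the mean value inequality then gains the third
  power.\<close>

lemma taylor_bound_2:
  fixes f :: "'e \<Rightarrow> 'b::real_normed_vector"
  assumes "open S" "smooth_on S f" "compact K" "convex K" "K \<subseteq> S"
  obtains C where "0 \<le> C" "\<And>x y. x \<in> K \<Longrightarrow> y \<in> K \<Longrightarrow>
    norm (f y - f x - frechet_derivative f (at x) (y - x) -
      (1/2) *\<^sub>R second_derivative f x (y - x) (y - x)) \<le> C * (norm (y - x))^3"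
proof -
  let ?D = "\<lambda>b z. frechet_derivative f (at z) b"
  have "\<exists>C\<ge>0. \<forall>x\<in>K. \<forall>y\<in>K. norm (?D b y - ?D b x - frechet_derivative (?D b) (at x) (y - x))
      \<le> C * (norm (y - x))\<^sup>2" for b
    by (rule taylor_bound_1[OF smooth_on_frechet_derivative[OF assms(2), of b] assms(3-5)]) blast
  then obtain C where C: "\<And>b. 0 \<le> C b"
    "\<And>b x y. x \<in> K \<Longrightarrow> y \<in> K \<Longrightarrow>
      norm (?D b y - ?D b x - frechet_derivative (?D b) (at x) (y - x)) \<le> C b * (norm (y - x))\<^sup>2" by metis
  obtain C' where C': "0 \<le> C'"
    "\<And>v r g. (\<And>b. b \<in> B \<Longrightarrow> norm (g b) \<le> C b * r) \<Longrightarrow>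
       norm (\<Sum>b\<in>B. c b v *\<^sub>R (g b :: 'b)) \<le> C' * norm v * r"
    using coordinate_combination_bound[of C] C(1) by metis
  show ?thesis
  proof
    fix x y assume xy: "x \<in> K" "y \<in> K"
    define h where "h = y - x"
    let ?H = "second_derivative f x"
    let ?f' = "\<lambda>s. frechet_derivative f (at (x + s *\<^sub>R h)) h - frechet_derivative f (at x) h - s *\<^sub>R ?H h h"
    \<comment> \<open>The function along the segment minus the linear and quadratic terms of its
      expansion; \<open>\<phi> 1 - \<phi> 0\<close> is the Taylor remainder, and \<open>?f'\<close>
      is the derivative of \<open>\<phi>\<close>.\<close>
    define \<phi> where "\<phi> s = f (x + s *\<^sub>R h) - s *\<^sub>R frechet_derivative f (at x) h - (s\<^sup>2 / 2) *\<^sub>R ?H h h" for s :: real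
    have inK: "x + s *\<^sub>R h \<in> K" if "s \<in> {0..1}" for s
    proof -
      have "(1 - s) *\<^sub>R x + s *\<^sub>R y \<in> K" using assms(4) xy that by (intro convexD_alt) auto
      then show ?thesis by (simp add: h_def algebra_simps)
    qed
    have "norm (\<phi> 1 - \<phi> 0) \<le> (C' * norm h * (norm h)\<^sup>2) * norm (1 - 0 :: real)"
    proof (rule differentiable_bound[of "{0..1}" \<phi> "\<lambda>s r. r *\<^sub>R ?f' s"])
      fix s :: real assume s: "s \<in> {0..1}"
      have "(f has_derivative frechet_derivative f (at (x + s *\<^sub>R h))) (at (x + s *\<^sub>R h))"
        using inK[OF s] assms by (auto intro: smooth_on_has_derivative)
      moreover have "((\<lambda>s. x + s *\<^sub>R h) has_derivative (\<lambda>r. r *\<^sub>R h)) (at s within {0..1})"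
        by (auto intro!: derivative_eq_intros)
      ultimately have "((\<lambda>s. f (x + s *\<^sub>R h)) has_derivative
          (\<lambda>r. frechet_derivative f (at (x + s *\<^sub>R h)) (r *\<^sub>R h))) (at s within {0..1})"
        using has_derivative_compose by blast
      then show "(\<phi> has_derivative (\<lambda>r. r *\<^sub>R ?f' s)) (at s within {0..1})"
        unfolding \<phi>_def using linear_scale[OF smooth_on_linear_derivative[OF assms(2), of "x + s *\<^sub>R h"]]
          inK[OF s] assms(5)
        by (auto intro!: derivative_eq_intros ext simp: subset_iff algebra_simps)
      show "onorm (\<lambda>r. r *\<^sub>R ?f' s) \<le> C' * norm h * (norm h)\<^sup>2"
      proof (rule onorm_bound)
        fix r :: real
        have "?H h h = (\<Sum>b\<in>B. c b h *\<^sub>R ?H h b)"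
          using xy assms(5) by (intro second_derivative_expansion[OF assms(1,2)]) auto
        moreover have "frechet_derivative f (at z) h = (\<Sum>b\<in>B. c b h *\<^sub>R ?D b z)" if "z \<in> K" for z
          using that assms(5) by (intro derivative_expansion[OF assms(2)]) auto
        ultimately have "?f' s = (\<Sum>b\<in>B. c b h *\<^sub>R (?D b (x + s *\<^sub>R h) - ?D b x - s *\<^sub>R ?H h b))"
          using inK[OF s] xy
          by (simp add: scaleR_diff_right sum_subtractf scaleR_sum_right mult.commute)
        also have "norm \<dots> \<le> C' * norm h * (norm h)\<^sup>2"
        proof (rule C'(2))
          fix b assume "b \<in> B"
          have lin: "linear (frechet_derivative (?D b) (at x))"
            using xy assms by (intro smooth_on_linear_derivative[of S] smooth_on_frechet_derivative) auto
          have "norm (?D b (x + s *\<^sub>R h) - ?D b x - s *\<^sub>R ?H h b) \<le> C b * (norm (s *\<^sub>R h))\<^sup>2"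
            using C(2)[OF xy(1) inK[OF s], of b] by (simp add: linear_scale[OF lin])
          also have "\<dots> \<le> C b * (norm h)\<^sup>2"
            using s C(1) by (intro mult_left_mono power_mono) (auto intro!: mult_left_le_one_le)
          finally show "norm (?D b (x + s *\<^sub>R h) - ?D b x - s *\<^sub>R ?H h b) \<le> C b * (norm h)\<^sup>2" .
        qed
        finally have "norm (?f' s) \<le> C' * norm h * (norm h)\<^sup>2" .
        then have "norm r * norm (?f' s) \<le> norm r * (C' * norm h * (norm h)\<^sup>2)"
          by (rule mult_left_mono) simp
        then show "norm (r *\<^sub>R ?f' s) \<le> C' * norm h * (norm h)\<^sup>2 * norm r"
          unfolding norm_scaleR by (simp add: mult_ac)
      qed (use C' in auto)
    qed auto
    then show "norm (f y - f x - frechet_derivative f (at x) (y - x) -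
        (1/2) *\<^sub>R ?H (y - x) (y - x)) \<le> C' * (norm (y - x))^3"
      by (simp add: \<phi>_def h_def power2_eq_square power3_eq_cube mult_ac algebra_simps)
  qed (rule C')
qed

section \<open>Symmetry of second derivatives\<close>

lemma compact_cball_finite_dim: "compact (cball (x::'e) r)"
proof -
  have "span B = UNIV"
  proof (intro equalityI subsetI)
    fix v :: 'e
    have "(\<Sum>b\<in>B. c b v *\<^sub>R b) \<in> span B" by (intro span_sum span_scale span_base)
    then show "v \<in> span B" by (simp only: expansion[of v, symmetric])
  qed simp
  then have "compact (cball (0::'e) r)" using compact_cball_Int_span[OF finite_B, of r] by simp
  then have "compact ((+) x ` cball 0 r)" by (rule compact_translation)
  then show ?thesis by (simp add: cball_translation)
qed

text \<open>Second-order expansion in the direction \<open>v\<close>, at z + s u and at z. The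
  difference of the first-order terms is expanded once more in the direction \<open>u\<close>; the
  difference of the second-order terms is of order s^3 because they are Lipschitz in the base
  point.\<close>

lemma second_difference_bound:
  fixes f :: "'e \<Rightarrow> 'b::real_normed_vector"
  assumes "open S" "smooth_on S f" "z \<in> S"
  obtains C r where "0 < r" "\<And>s. 0 < s \<Longrightarrow> s < r \<Longrightarrow>
    norm (f (z + s *\<^sub>R u + s *\<^sub>R v) - f (z + s *\<^sub>R u) - f (z + s *\<^sub>R v) + f z -
      s\<^sup>2 *\<^sub>R second_derivative f z u v) \<le> C * s^3"
proof -
  obtain \<epsilon> where \<epsilon>: "0 < \<epsilon>" "cball z \<epsilon> \<subseteq> S" using assms by (meson open_contains_cball)
  note K = compact_cball_finite_dim[of z \<epsilon>] convex_cball[of z \<epsilon>] \<epsilon>(2)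
  let ?D = "\<lambda>z. frechet_derivative f (at z) v"
  let ?H = "\<lambda>z. frechet_derivative ?D (at z) v"
  have sD: "smooth_on S ?D" "smooth_on S ?H" by (intro smooth_on_frechet_derivative assms)+
  obtain C2 where C2: "0 \<le> C2" "\<And>x y. x \<in> cball z \<epsilon> \<Longrightarrow> y \<in> cball z \<epsilon> \<Longrightarrow>
    norm (f y - f x - frechet_derivative f (at x) (y - x) -
      (1/2) *\<^sub>R second_derivative f x (y - x) (y - x)) \<le> C2 * (norm (y - x))^3"
    using taylor_bound_2[OF assms(1,2) K] by blast
  obtain C1 where C1: "0 \<le> C1" "\<And>x y. x \<in> cball z \<epsilon> \<Longrightarrow> y \<in> cball z \<epsilon> \<Longrightarrow>
    norm (?D y - ?D x - frechet_derivative ?D (at x) (y - x)) \<le> C1 * (norm (y - x))\<^sup>2"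
    using taylor_bound_1[OF sD(1) K] by blast
  obtain C0 where C0: "0 \<le> C0" "\<And>x y. x \<in> cball z \<epsilon> \<Longrightarrow> y \<in> cball z \<epsilon> \<Longrightarrow>
    norm (?H y - ?H x) \<le> C0 * norm (y - x)"
    using lipschitz_bound[OF sD(2) K] by blast
  \<comment> \<open>Keeps all corners of the parallelogram in the ball on which the estimates hold;
    the summand \<open>1\<close> makes the denominator positive.\<close>
  define r where "r = \<epsilon> / (norm u + norm v + 1)"
  show ?thesis
  proof
    show "0 < r" using \<epsilon> by (simp add: r_def add_nonneg_pos)
    fix s :: real assume s: "0 < s" "s < r"
    have "s * norm u + s * norm v + s < \<epsilon>"
      using s(2) unfolding r_def by (simp add: pos_less_divide_eq add_nonneg_pos distrib_left)
    moreover have "s * norm u \<ge> 0" "s * norm v \<ge> 0" using s by auto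
    ultimately have sm: "s * norm u + s * norm v < \<epsilon>" "s * norm u < \<epsilon>" "s * norm v < \<epsilon>"
      using s(1) by linarith+
    have "norm (s *\<^sub>R v + s *\<^sub>R u) \<le> s * norm u + s * norm v"
      using norm_triangle_ineq[of "s *\<^sub>R v" "s *\<^sub>R u"] s by simp
    then have mem: "z \<in> cball z \<epsilon>" "z + s *\<^sub>R u \<in> cball z \<epsilon>" "z + s *\<^sub>R v \<in> cball z \<epsilon>"
        "z + s *\<^sub>R u + s *\<^sub>R v \<in> cball z \<epsilon>"
      using sm s \<epsilon> by (auto simp: dist_norm add.assoc norm_minus_commute)
    have sec: "second_derivative f w (s *\<^sub>R v) (s *\<^sub>R v) = s\<^sup>2 *\<^sub>R ?H w" if "w \<in> cball z \<epsilon>" for w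
      using bilinear_lmul[OF bilinear_second_derivative[OF assms(1,2)]]
        bilinear_rmul[OF bilinear_second_derivative[OF assms(1,2)]] that \<epsilon>(2)
      by (auto simp: power2_eq_square)
    have fst: "frechet_derivative f (at w) (s *\<^sub>R v) = s *\<^sub>R ?D w" if "w \<in> cball z \<epsilon>" for w
      using that \<epsilon>(2) by (intro linear_scale smooth_on_linear_derivative[OF assms(2)]) auto
    have fstD: "frechet_derivative ?D (at z) (s *\<^sub>R u) = s *\<^sub>R frechet_derivative ?D (at z) u"
      by (intro linear_scale smooth_on_linear_derivative[OF sD(1) assms(3)])
    define e1 where "e1 = f (z + s *\<^sub>R u + s *\<^sub>R v) - f (z + s *\<^sub>R u) - s *\<^sub>R ?D (z + s *\<^sub>R u) - (s\<^sup>2/2) *\<^sub>R ?H (z + s *\<^sub>R u)"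
    define e2 where "e2 = f (z + s *\<^sub>R v) - f z - s *\<^sub>R ?D z - (s\<^sup>2/2) *\<^sub>R ?H z"
    define e3 where "e3 = ?D (z + s *\<^sub>R u) - ?D z - s *\<^sub>R frechet_derivative ?D (at z) u"
    define e4 where "e4 = ?H (z + s *\<^sub>R u) - ?H z"
    have "norm e1 \<le> C2 * (s * norm v)^3"
      using C2(2)[OF mem(2,4)] s by (simp add: fst[OF mem(2)] sec[OF mem(2)] e1_def)
    moreover have "norm e2 \<le> C2 * (s * norm v)^3"
      using C2(2)[OF mem(1,3)] s by (simp add: fst[OF mem(1)] sec[OF mem(1)] e2_def)
    moreover have "norm (s *\<^sub>R e3) \<le> s * (C1 * (s * norm u)\<^sup>2)"
      using C1(2)[OF mem(1,2)] s by (simp add: fstD e3_def)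
    moreover have "norm ((s\<^sup>2/2) *\<^sub>R e4) \<le> (s\<^sup>2/2) * (C0 * (s * norm u))"
      using C0(2)[OF mem(1,2)] s by (simp add: e4_def)
    moreover have "norm (e1 - e2 + s *\<^sub>R e3 + (s\<^sup>2/2) *\<^sub>R e4)
        \<le> norm e1 + norm e2 + norm (s *\<^sub>R e3) + norm ((s\<^sup>2/2) *\<^sub>R e4)"
      by (meson add_mono norm_triangle_ineq norm_triangle_ineq4 norm_triangle_mono order_refl order_trans)
    ultimately have "norm (e1 - e2 + s *\<^sub>R e3 + (s\<^sup>2/2) *\<^sub>R e4) \<le>
        C2 * (s * norm v)^3 + C2 * (s * norm v)^3 + s * (C1 * (s * norm u)\<^sup>2) + (s\<^sup>2/2) * (C0 * (s * norm u))"
      by linarith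
    also have "\<dots> = (2 * C2 * norm v ^ 3 + C1 * norm u ^ 2 + C0 * norm u / 2) * s ^ 3"
      by (simp add: power2_eq_square power3_eq_cube algebra_simps)
    also have "e1 - e2 + s *\<^sub>R e3 + (s\<^sup>2/2) *\<^sub>R e4 =
      f (z + s *\<^sub>R u + s *\<^sub>R v) - f (z + s *\<^sub>R u) - f (z + s *\<^sub>R v) + f z -
      s\<^sup>2 *\<^sub>R second_derivative f z u v"
      unfolding e1_def e2_def e3_def e4_def
      by (simp add: scaleR_diff_right scaleR_add_right power2_eq_square)
    finally show "norm (f (z + s *\<^sub>R u + s *\<^sub>R v) - f (z + s *\<^sub>R u) - f (z + s *\<^sub>R v) + f z -
      s\<^sup>2 *\<^sub>R second_derivative f z u v) \<le> (2 * C2 * norm v ^ 3 + C1 * norm u ^ 2 + C0 * norm u / 2) * s ^ 3" .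
  qed
qed

text \<open>The second difference does not depend on the order of \<open>u\<close> and
  \<open>v\<close>. Both mixed derivatives, times s^2, approximate it up to order s^3; dividing by
  s^2 and letting s tend to 0 identifies them.\<close>

lemma second_derivative_symmetric:
  fixes f :: "'e \<Rightarrow> 'b::real_normed_vector"
  assumes "open S" "smooth_on S f" "z \<in> S"
  shows "second_derivative f z u v = second_derivative f z v u"
proof -
  define \<Delta> where "\<Delta> = norm (second_derivative f z u v - second_derivative f z v u)"
  obtain C1 r1 where 1: "0 < r1" "\<And>s. 0 < s \<Longrightarrow> s < r1 \<Longrightarrow>
    norm (f (z + s *\<^sub>R u + s *\<^sub>R v) - f (z + s *\<^sub>R u) - f (z + s *\<^sub>R v) + f z -
      s\<^sup>2 *\<^sub>R second_derivative f z u v) \<le> C1 * s^3"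
    using second_difference_bound[OF assms] by blast
  obtain C2 r2 where 2: "0 < r2" "\<And>s. 0 < s \<Longrightarrow> s < r2 \<Longrightarrow>
    norm (f (z + s *\<^sub>R v + s *\<^sub>R u) - f (z + s *\<^sub>R v) - f (z + s *\<^sub>R u) + f z -
      s\<^sup>2 *\<^sub>R second_derivative f z v u) \<le> C2 * s^3"
    using second_difference_bound[OF assms] by blast
  have "\<Delta> \<le> (C1 + C2) * s" if s: "0 < s" "s < min r1 r2" for s
  proof -
    define E where "E = f (z + s *\<^sub>R u + s *\<^sub>R v) - f (z + s *\<^sub>R u) - f (z + s *\<^sub>R v) + f z"
    have "norm (E - s\<^sup>2 *\<^sub>R second_derivative f z u v) \<le> C1 * s^3" using 1(2)[of s] s by (simp add: E_def)
    moreover have "norm (E - s\<^sup>2 *\<^sub>R second_derivative f z v u) \<le> C2 * s^3"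
      using 2(2)[of s] s by (simp add: E_def algebra_simps)
    ultimately have "norm ((E - s\<^sup>2 *\<^sub>R second_derivative f z v u) - (E - s\<^sup>2 *\<^sub>R second_derivative f z u v)) \<le> (C1 + C2) * s^3"
      using norm_triangle_ineq4[of "E - s\<^sup>2 *\<^sub>R second_derivative f z v u" "E - s\<^sup>2 *\<^sub>R second_derivative f z u v"]
      by (simp add: algebra_simps)
    also have "(E - s\<^sup>2 *\<^sub>R second_derivative f z v u) - (E - s\<^sup>2 *\<^sub>R second_derivative f z u v) =
      s\<^sup>2 *\<^sub>R (second_derivative f z u v - second_derivative f z v u)" by (simp add: scaleR_diff_right)
    finally have "s\<^sup>2 * \<Delta> \<le> s\<^sup>2 * ((C1 + C2) * s)"
      by (simp add: \<Delta>_def power2_eq_square power3_eq_cube mult_ac)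
    then show ?thesis using s by (simp add: mult_le_cancel_left)
  qed
  then have "eventually (\<lambda>s. \<Delta> \<le> (C1 + C2) * s) (at_right 0)"
    using 1(1) 2(1) by (auto simp: eventually_at_right_field intro!: exI[of _ "min r1 r2"])
  moreover have "((\<lambda>s. (C1 + C2) * s) \<longlongrightarrow> 0) (at_right 0)" by (auto intro!: tendsto_eq_intros)
  ultimately have "\<Delta> \<le> 0" by (intro tendsto_lowerbound[of _ 0 "at_right 0"]) auto
  then show ?thesis by (simp add: \<Delta>_def)
qed

end

section \<open>The Euler scheme\<close>

text \<open>
  A discrete sewing argument: the interval \<open>{i..k}\<close> is split at the single step across which the
  control \<open>W i \<cdot>\<close> passes half of \<open>W i k\<close>; that step itself carries no error, and superadditivity
  leaves at most half of \<open>W i k\<close> on both remaining pieces.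
\<close>
lemma discrete_sewing:
  fixes J :: "nat \<Rightarrow> nat \<Rightarrow> 'e::real_normed_vector" and W :: "nat \<Rightarrow> nat \<Rightarrow> real"
  assumes W_nonneg: "\<And>i k. i \<le> k \<Longrightarrow> k \<le> n \<Longrightarrow> 0 \<le> W i k"
    and W_super: "\<And>i j k. i \<le> j \<Longrightarrow> j \<le> k \<Longrightarrow> k \<le> n \<Longrightarrow> W i j + W j k \<le> W i k"
    and \<theta>: "1 < \<theta>" and C: "0 \<le> C" and L: "0 \<le> L" "2 * C + 2 powr (1 - \<theta>) * L \<le> L"
    and J_refl: "\<And>i. i \<le> n \<Longrightarrow> J i i = 0" and J_Suc: "\<And>i. i < n \<Longrightarrow> J i (Suc i) = 0"
    and J_split: "\<And>i j k. i < j \<Longrightarrow> j < k \<Longrightarrow> k \<le> n \<Longrightarrow> norm (J i j) \<le> L * W i j powr \<theta> \<Longrightarrow>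
      norm (J i k - J i j - J j k) \<le> C * W i k powr \<theta>"
    and ik: "i \<le> k" "k \<le> n"
  shows "norm (J i k) \<le> L * W i k powr \<theta>"
  using ik
proof (induction "k - i" arbitrary: i k rule: less_induct)
  case less
  note ik = less.prems
  have W_mono: "W a b \<le> W a' b'" if "a' \<le> a" "a \<le> b" "b \<le> b'" "b' \<le> n" for a b a' b'
  proof -
    have "W a' a + W a b' \<le> W a' b'" "W a b + W b b' \<le> W a b'" using that by (auto intro!: W_super)
    moreover have "0 \<le> W a' a" "0 \<le> W b b'" using that by (auto intro!: W_nonneg)
    ultimately show ?thesis by linarith
  qed
  define w where "w = W i k"
  have w: "0 \<le> w" unfolding w_def using ik by (rule W_nonneg)
  have half: "L * W a b powr \<theta> \<le> L * (w / 2) powr \<theta>" if "a \<le> b" "b \<le> n" "W a b \<le> w / 2" for a b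
    using that L(1) \<theta> W_nonneg[of a b] by (intro mult_left_mono powr_mono2) auto
  show ?case
  proof (cases "k \<le> Suc i")
    case True
    then have "J i k = 0" using ik J_refl J_Suc[of i] by (cases "k = i") (auto simp: le_Suc_eq)
    then show ?thesis using L by simp
  next
    case False
    \<comment> \<open>The candidates for the left end of the exceptional step. The index
      \<open>i\<close> is among them, because superadditivity on a degenerate interval forces
      \<open>W i i \<le> 0\<close>.\<close>
    define S where "S = {j \<in> {i..<k}. W i j \<le> w / 2}"
    have "W i i \<le> 0" using W_super[of i i i] ik by simp
    then have S: "finite S" "i \<in> S" using w ik False by (auto simp: S_def)
    define u where "u = Max S"
    have "u \<in> S" unfolding u_def using S by (intro Max_in) auto
    then have u: "i \<le> u" "u < k" "W i u \<le> w / 2" by (auto simp: S_def)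
    have u': "w / 2 < W i (Suc u)" if "Suc u < k"
    proof (rule ccontr)
      assume "\<not> w / 2 < W i (Suc u)"
      then have "Suc u \<in> S" using that u by (auto simp: S_def)
      then have "Suc u \<le> u" unfolding u_def using S by (intro Max_ge) auto
      then show False by simp
    qed
    have A: "norm (J i u) \<le> L * (w / 2) powr \<theta>"
    proof -
      have "norm (J i u) \<le> L * W i u powr \<theta>" using less.hyps[of u i] u ik by auto
      also have "\<dots> \<le> L * (w / 2) powr \<theta>" using u ik by (intro half) auto
      finally show ?thesis .
    qed
    have B: "norm (J i (Suc u)) \<le> L * (w / 2) powr \<theta> + C * w powr \<theta>"
    proof (cases "u = i")
      case True
      then show ?thesis using J_Suc[of i] u ik C L by simp
    next
      case False
      \<comment> \<open>\<open>J_split\<close> takes the estimate on its left piece as a premise;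
        the induction hypothesis supplies it because that piece is shorter than
        \<open>{i..k}\<close>.\<close>
      have "norm (J i (Suc u) - J i u - J u (Suc u)) \<le> C * W i (Suc u) powr \<theta>"
        using False u ik less.hyps[of u i] by (intro J_split) auto
      also have "\<dots> \<le> C * w powr \<theta>" unfolding w_def using u ik \<theta> C W_nonneg[of i "Suc u"]
        by (intro mult_left_mono powr_mono2 W_mono) auto
      finally have "norm (J i (Suc u) - J i u) \<le> C * w powr \<theta>" using J_Suc[of u] u ik by simp
      then show ?thesis using A norm_triangle_sub[of "J i (Suc u)" "J i u"] by linarith
    qed
    have "norm (J i k) \<le> 2 * (L * (w / 2) powr \<theta>) + 2 * (C * w powr \<theta>)"
    proof (cases "Suc u = k")
      case True
      have "0 \<le> L * (w / 2) powr \<theta>" "0 \<le> C * w powr \<theta>" using L C by auto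
      then show ?thesis using B unfolding True by linarith
    next
      case False
      then have uk: "Suc u < k" using u by simp
      have "W i (Suc u) + W (Suc u) k \<le> w" unfolding w_def using u uk ik by (intro W_super) auto
      then have "W (Suc u) k \<le> w / 2" using u'[OF uk] by linarith
      then have "L * W (Suc u) k powr \<theta> \<le> L * (w / 2) powr \<theta>" using uk ik by (intro half) auto
      moreover have "norm (J (Suc u) k) \<le> L * W (Suc u) k powr \<theta>"
        using less.hyps[of k "Suc u"] uk u ik by auto
      moreover have "norm (J i k - J i (Suc u) - J (Suc u) k) \<le> C * w powr \<theta>" unfolding w_def
        using u uk ik less.hyps[of "Suc u" i] by (intro J_split) auto
      moreover have "norm (J i k) \<le> norm (J i k - J i (Suc u) - J (Suc u) k) + norm (J i (Suc u)) + norm (J (Suc u) k)"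
        using norm_triangle_ineq[of "J i k - J i (Suc u) - J (Suc u) k" "J i (Suc u) + J (Suc u) k"]
          norm_triangle_ineq[of "J i (Suc u)" "J (Suc u) k"] by simp
      ultimately show ?thesis using B by linarith
    qed
    \<comment> \<open>Two pieces of half the size give the factor
      \<open>2 powr (1 - \<theta>)\<close>, which is less than 1 as \<theta> > 1; the two joins give
      \<open>2 * C\<close>. The condition on \<open>L\<close> closes the induction.\<close>
    also have "\<dots> = (2 * C + 2 powr (1 - \<theta>) * L) * w powr \<theta>"
      using w by (simp add: powr_divide powr_diff algebra_simps)
    also have "\<dots> \<le> L * w powr \<theta>" using L by (intro mult_right_mono) auto
    finally show ?thesis unfolding w_def .
  qed
qed

text \<open>\<open>\<psi> i j\<close> is meant to be the derivative of the field
  \<open>\<xi> j\<close> along \<open>\<xi> i\<close>, so the first index of \<open>W\<close>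
  belongs to the field that differentiates.\<close>

definition euler_increment ::
  "('k::finite \<Rightarrow> 'e \<Rightarrow> 'e::real_normed_vector) \<Rightarrow> ('k \<Rightarrow> 'k \<Rightarrow> 'e \<Rightarrow> 'e) \<Rightarrow>
    'e \<Rightarrow> real^'k \<Rightarrow> real^'k^'k \<Rightarrow> 'e" where
  "euler_increment \<xi> \<psi> z v W =
     (\<Sum>i\<in>UNIV. v $ i *\<^sub>R \<xi> i z) + (\<Sum>i\<in>UNIV. \<Sum>j\<in>UNIV. W $ i $ j *\<^sub>R \<psi> i j z)"

lemma norm_vec_combination_le:
  fixes v :: "real^'k" and g :: "'k \<Rightarrow> 'e::real_normed_vector"
  assumes "norm v \<le> r" "\<And>i. norm (g i) \<le> M"
  shows "norm (\<Sum>i\<in>UNIV. v $ i *\<^sub>R g i) \<le> real CARD('k) * (r * M)"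
proof -
  have "norm (\<Sum>i\<in>UNIV. v $ i *\<^sub>R g i) \<le> of_nat (card (UNIV :: 'k set)) * (r * M)"
  proof (rule sum_norm_bound)
    fix i
    have "\<bar>v $ i\<bar> \<le> r" using component_le_norm_cart[of v i] assms(1) by linarith
    then show "norm (v $ i *\<^sub>R g i) \<le> r * M"
      using assms(2)[of i] by (auto intro!: mult_mono)
  qed
  then show ?thesis by simp
qed

lemma norm_matrix_combination_le:
  fixes W :: "real^'k^'k" and g :: "'k \<Rightarrow> 'k \<Rightarrow> 'e::real_normed_vector"
  assumes "norm W \<le> r" "\<And>i j. norm (g i j) \<le> M"
  shows "norm (\<Sum>i\<in>UNIV. \<Sum>j\<in>UNIV. W $ i $ j *\<^sub>R g i j) \<le> (real CARD('k))\<^sup>2 * (r * M)"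
proof -
  have "norm (\<Sum>i\<in>UNIV. \<Sum>j\<in>UNIV. W $ i $ j *\<^sub>R g i j) \<le>
      of_nat (card (UNIV :: 'k set)) * (real CARD('k) * (r * M))"
  proof (rule sum_norm_bound)
    fix i
    have "norm (W $ i) \<le> r" by (rule order_trans[OF Finite_Cartesian_Product.norm_nth_le assms(1)])
    then show "norm (\<Sum>j\<in>UNIV. W $ i $ j *\<^sub>R g i j) \<le> real CARD('k) * (r * M)"
      using assms(2) by (rule norm_vec_combination_le)
  qed
  then show ?thesis by (simp add: power2_eq_square)
qed

text \<open>Separates the estimates on which the scheme rests from the smoothness that yields them,
  with one constant for all. \<open>D i z\<close> plays the derivative of \<open>\<xi> i\<close> at
  z.\<close>

locale euler_fields =
  fixes K :: "'e::real_normed_vector set"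
    and \<xi> :: "'k::finite \<Rightarrow> 'e \<Rightarrow> 'e" and \<psi> :: "'k \<Rightarrow> 'k \<Rightarrow> 'e \<Rightarrow> 'e" and D :: "'k \<Rightarrow> 'e \<Rightarrow> 'e \<Rightarrow> 'e"
    and M :: real
  assumes M_nonneg: "0 \<le> M"
    and \<xi>_bound: "z \<in> K \<Longrightarrow> norm (\<xi> i z) \<le> M"
    and \<psi>_bound: "z \<in> K \<Longrightarrow> norm (\<psi> i j z) \<le> M"
    and D_linear: "z \<in> K \<Longrightarrow> linear (D i z)"
    and D_bound: "z \<in> K \<Longrightarrow> norm (D i z v) \<le> M * norm v"
    and \<psi>_eq: "z \<in> K \<Longrightarrow> \<psi> i j z = D j z (\<xi> i z)"
    and \<xi>_taylor: "a \<in> K \<Longrightarrow> b \<in> K \<Longrightarrow> norm (\<xi> i b - \<xi> i a - D i a (b - a)) \<le> M * (norm (b - a))\<^sup>2"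
    and \<psi>_lipschitz: "a \<in> K \<Longrightarrow> b \<in> K \<Longrightarrow> norm (\<psi> i j b - \<psi> i j a) \<le> M * norm (b - a)"
begin

abbreviation \<mu> :: "'e \<Rightarrow> real^'k \<Rightarrow> real^'k^'k \<Rightarrow> 'e" where
  "\<mu> \<equiv> euler_increment \<xi> \<psi>"

definition G :: real where
  "G = real CARD('k) * M + (real CARD('k))\<^sup>2 * M"

text \<open>The summands are the three sources of error in \<open>\<mu>_chen_defect\<close>: the
  Taylor remainder of the fields, the derivative applied to the second-order part of the
  displacement, and the variation of \<open>\<psi>\<close>.\<close>

definition C :: real where
  "C = real CARD('k) * (M * (G + 1)\<^sup>2) + real CARD('k) * (M * (1 + (real CARD('k))\<^sup>2 * M)) +
     (real CARD('k))\<^sup>2 * (M * (G + 1))"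

lemma G_nonneg: "0 \<le> G" and C_nonneg: "0 \<le> C"
  using M_nonneg by (auto simp: G_def C_def intro!: add_nonneg_nonneg mult_nonneg_nonneg)

lemma \<mu>_bound:
  assumes "z \<in> K" "0 \<le> \<rho>" "\<rho> \<le> 1" "norm v \<le> \<rho>" "norm W \<le> \<rho>\<^sup>2"
  shows "norm (\<mu> z v W) \<le> G * \<rho>"
proof -
  have "norm (\<mu> z v W) \<le> real CARD('k) * (\<rho> * M) + (real CARD('k))\<^sup>2 * (\<rho>\<^sup>2 * M)"
    unfolding euler_increment_def using assms \<xi>_bound[OF assms(1)] \<psi>_bound[OF assms(1)]
    by (intro order_trans[OF norm_triangle_ineq] add_mono norm_vec_combination_le norm_matrix_combination_le) auto
  also have "\<dots> \<le> real CARD('k) * (\<rho> * M) + (real CARD('k))\<^sup>2 * (\<rho> * M)"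
    using assms M_nonneg
    by (intro add_mono order_refl mult_left_mono mult_right_mono) (auto simp: power2_eq_square mult_left_le)
  finally show ?thesis by (simp add: G_def algebra_simps)
qed

text \<open>Moving the base point from a to b changes \<open>\<xi> j\<close> to first order by its
  derivative along the leading part of the displacement; paired with \<open>v2\<close>, this is
  exactly the contribution of \<open>tensor v1 v2\<close>, and the two cancel. Second order suffices
  in \<open>ab\<close>, because the deviation always meets a factor \<open>v2\<close> or
  \<open>W2\<close>.\<close>

lemma \<mu>_chen_defect:
  assumes K: "a \<in> K" "b \<in> K" and \<rho>: "0 \<le> \<rho>" "\<rho> \<le> 1"
    and v: "norm v1 \<le> \<rho>" "norm v2 \<le> \<rho>" and W: "norm W1 \<le> \<rho>\<^sup>2" "norm W2 \<le> \<rho>\<^sup>2"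
    and ab: "norm (b - a - \<mu> a v1 W1) \<le> \<rho>\<^sup>2"
  shows "norm (\<mu> a v1 W1 + \<mu> b v2 W2 - \<mu> a (v1 + v2) (W1 + W2 + tensor v1 v2)) \<le> C * \<rho>^3"
proof -
  let ?N = "real CARD('k)"
  \<comment> \<open>The displacement beyond its leading part. It has order 2 in \<rho>, since both
    the deviation in \<open>ab\<close> and the \<open>W1\<close> part do.\<close>
  define e where "e = b - a - (\<Sum>i\<in>UNIV. v1 $ i *\<^sub>R \<xi> i a)"
  have "\<rho>\<^sup>2 \<le> \<rho>" using \<rho> by (simp add: power2_eq_square mult_left_le)
  have ba: "norm (b - a) \<le> (G + 1) * \<rho>"
    using norm_triangle_ineq[of "b - a - \<mu> a v1 W1" "\<mu> a v1 W1"] ab \<mu>_bound[OF K(1) \<rho> v(1) W(1)] \<open>\<rho>\<^sup>2 \<le> \<rho>\<close>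
    by (simp add: distrib_right)
  have "norm (e - (\<Sum>i\<in>UNIV. \<Sum>j\<in>UNIV. W1 $ i $ j *\<^sub>R \<psi> i j a)) \<le> \<rho>\<^sup>2"
    using ab by (simp add: e_def euler_increment_def diff_diff_eq add.assoc)
  moreover have "norm (\<Sum>i\<in>UNIV. \<Sum>j\<in>UNIV. W1 $ i $ j *\<^sub>R \<psi> i j a) \<le> ?N\<^sup>2 * (\<rho>\<^sup>2 * M)"
    using W(1) \<psi>_bound[OF K(1)] by (intro norm_matrix_combination_le)
  ultimately have e: "norm e \<le> (1 + ?N\<^sup>2 * M) * \<rho>\<^sup>2"
    using norm_triangle_sub[of e "\<Sum>i\<in>UNIV. \<Sum>j\<in>UNIV. W1 $ i $ j *\<^sub>R \<psi> i j a"] by (simp add: algebra_simps)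
  have Dba: "D j a (b - a) = (\<Sum>i\<in>UNIV. v1 $ i *\<^sub>R \<psi> i j a) + D j a e" for j
  proof -
    have "D j a (b - a) = D j a ((\<Sum>i\<in>UNIV. v1 $ i *\<^sub>R \<xi> i a) + e)" by (simp add: e_def)
    also have "\<dots> = (\<Sum>i\<in>UNIV. v1 $ i *\<^sub>R D j a (\<xi> i a)) + D j a e"
      by (simp add: linear_add[OF D_linear[OF K(1)]] linear_sum[OF D_linear[OF K(1)]]
          linear_scale[OF D_linear[OF K(1)]])
    finally show ?thesis by (simp add: \<psi>_eq[OF K(1)])
  qed
  define R where "R j = \<xi> j b - \<xi> j a - D j a (b - a)" for j
  have tens: "(\<Sum>i\<in>UNIV. \<Sum>j\<in>UNIV. tensor v1 v2 $ i $ j *\<^sub>R \<psi> i j a) =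
      (\<Sum>j\<in>UNIV. v2 $ j *\<^sub>R (\<Sum>i\<in>UNIV. v1 $ i *\<^sub>R \<psi> i j a))"
    by (subst sum.swap) (simp add: tensor_def scaleR_sum_right mult.commute)
  have "\<mu> a v1 W1 + \<mu> b v2 W2 - \<mu> a (v1 + v2) (W1 + W2 + tensor v1 v2) =
      (\<Sum>j\<in>UNIV. v2 $ j *\<^sub>R (\<xi> j b - \<xi> j a)) - (\<Sum>i\<in>UNIV. \<Sum>j\<in>UNIV. tensor v1 v2 $ i $ j *\<^sub>R \<psi> i j a)
      + (\<Sum>i\<in>UNIV. \<Sum>j\<in>UNIV. W2 $ i $ j *\<^sub>R (\<psi> i j b - \<psi> i j a))"
    by (simp add: euler_increment_def scaleR_add_left scaleR_diff_right sum.distrib sum_subtractf)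
  also have "(\<Sum>j\<in>UNIV. v2 $ j *\<^sub>R (\<xi> j b - \<xi> j a)) - (\<Sum>i\<in>UNIV. \<Sum>j\<in>UNIV. tensor v1 v2 $ i $ j *\<^sub>R \<psi> i j a)
     = (\<Sum>j\<in>UNIV. v2 $ j *\<^sub>R R j) + (\<Sum>j\<in>UNIV. v2 $ j *\<^sub>R D j a e)"
    unfolding tens R_def Dba sum_subtractf[symmetric] sum.distrib[symmetric]
    by (intro sum.cong) (simp_all add: scaleR_diff_right scaleR_add_right)
  finally have eq: "\<mu> a v1 W1 + \<mu> b v2 W2 - \<mu> a (v1 + v2) (W1 + W2 + tensor v1 v2) =
     (\<Sum>j\<in>UNIV. v2 $ j *\<^sub>R R j) + (\<Sum>j\<in>UNIV. v2 $ j *\<^sub>R D j a e)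
      + (\<Sum>i\<in>UNIV. \<Sum>j\<in>UNIV. W2 $ i $ j *\<^sub>R (\<psi> i j b - \<psi> i j a))" .
  have R: "norm (R j) \<le> M * ((G + 1) * \<rho>)\<^sup>2" for j
    using \<xi>_taylor[OF K, of j] power_mono[OF ba norm_ge_zero, of 2] M_nonneg
    unfolding R_def by (meson mult_left_mono order_trans)
  have De: "norm (D j a e) \<le> M * ((1 + ?N\<^sup>2 * M) * \<rho>\<^sup>2)" for j
    using D_bound[OF K(1), of j e] e M_nonneg by (meson mult_left_mono order_trans)
  have Psi: "norm (\<psi> i j b - \<psi> i j a) \<le> M * ((G + 1) * \<rho>)" for i j
    using \<psi>_lipschitz[OF K, of i j] ba M_nonneg by (meson mult_left_mono order_trans)
  have "norm (\<mu> a v1 W1 + \<mu> b v2 W2 - \<mu> a (v1 + v2) (W1 + W2 + tensor v1 v2)) \<le>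
    ?N * (\<rho> * (M * ((G + 1) * \<rho>)\<^sup>2)) + ?N * (\<rho> * (M * ((1 + ?N\<^sup>2 * M) * \<rho>\<^sup>2))) +
    ?N\<^sup>2 * (\<rho>\<^sup>2 * (M * ((G + 1) * \<rho>)))"
    unfolding eq using v(2) W(2) R De Psi
    by (intro norm_triangle_le add_mono norm_vec_combination_le norm_matrix_combination_le)
  also have "\<dots> = C * \<rho>^3"
    by (simp add: C_def power2_eq_square power3_eq_cube algebra_simps)
  finally show ?thesis .
qed

end

section \<open>Controls and the Euler scheme of a rough path\<close>

lemma control_mono:
  assumes "control T \<omega>" "0 \<le> s'" "s' \<le> s" "s \<le> t" "t \<le> t'" "t' \<le> T"
  shows "\<omega> s t \<le> \<omega> s' t'"
proof -
  have "\<omega> s' s + \<omega> s t' \<le> \<omega> s' t'" "\<omega> s t + \<omega> t t' \<le> \<omega> s t'" "0 \<le> \<omega> s' s" "0 \<le> \<omega> t t'"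
    using assms by (auto simp: control_def)
  then show ?thesis by linarith
qed

lemma control_nonneg: "control T \<omega> \<Longrightarrow> 0 \<le> s \<Longrightarrow> s \<le> t \<Longrightarrow> t \<le> T \<Longrightarrow> 0 \<le> \<omega> s t"
  by (simp add: control_def)

text \<open>All estimates are made in powers of the scale \<open>\<omega> s t powr (1 / p)\<close>.
  The exponent is a successor because \<open>0 powr 0 = 0\<close>, whereas
  \<open>0 ^ 0 = 1\<close>.\<close>

lemma powr_inverse_power: "(w powr (1 / p)) ^ Suc n = w powr (real (Suc n) / p)"
  for w p :: real
  by (cases "w = 0") (simp_all add: powr_power del: power_Suc)

lemma rough_path_bounds:
  assumes "weak_geometric_rough_path T p \<omega> x \<X>" "0 \<le> s" "s \<le> t" "t \<le> T"
  shows "norm (x t - x s) \<le> \<omega> s t powr (1 / p)" "norm (\<X> s t) \<le> (\<omega> s t powr (1 / p))\<^sup>2"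
  using assms powr_inverse_power[of "\<omega> s t" p 1]
  by (auto simp: weak_geometric_rough_path_def numeral_2_eq_2)

text \<open>The inequality for \<open>L\<close> is the one of \<open>discrete_sewing\<close> with
  \<theta> = 3/p. Of the smallness conditions, the first makes higher powers of the scale smaller,
  the second turns a third-order error with factor \<open>L\<close> into a second-order one, and the
  third confines the scheme to the ball.\<close>

locale rough_euler = euler_fields "cball z0 r" \<xi> \<psi> D M
  for z0 :: "'e::real_normed_vector" and r and \<xi> :: "'k::finite \<Rightarrow> 'e \<Rightarrow> 'e" and \<psi> D M +
  fixes T p \<tau> :: real and \<omega> :: "real \<Rightarrow> real \<Rightarrow> real" and x :: "real \<Rightarrow> real^'k"
    and \<X> :: "real \<Rightarrow> real \<Rightarrow> real^'k^'k" and L :: real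
  assumes p: "1 \<le> p" "p < 3" and \<tau>: "0 \<le> \<tau>" "\<tau> \<le> T"
    and control: "control T \<omega>" and rough_path: "weak_geometric_rough_path T p \<omega> x \<X>"
    and L: "0 \<le> L" "2 * C + 2 powr (1 - 3 / p) * L \<le> L"
    and small: "\<omega> 0 \<tau> powr (1 / p) \<le> 1" "L * \<omega> 0 \<tau> powr (1 / p) \<le> 1"
      "(G + L) * \<omega> 0 \<tau> powr (1 / p) \<le> r"
begin

abbreviation incr :: "'e \<Rightarrow> real \<Rightarrow> real \<Rightarrow> 'e" where
  "incr z s t \<equiv> \<mu> z (x t - x s) (\<X> s t)"

lemma root_control_mono:
  assumes "0 \<le> s'" "s' \<le> s" "s \<le> t" "t \<le> t'" "t' \<le> \<tau>"
  shows "\<omega> s t powr (1 / p) \<le> \<omega> s' t' powr (1 / p)"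
  using assms p \<tau> control_mono[OF control, of s' s t t'] control_nonneg[OF control, of s t]
  by (intro powr_mono2) auto

lemma powr_3_over_p: "\<omega> s t powr (3 / p) = (\<omega> s t powr (1 / p)) ^ 3"
  using powr_inverse_power[of "\<omega> s t" p 2] by (simp add: numeral_3_eq_3)

lemma incr_bound:
  assumes "z \<in> cball z0 r" "0 \<le> s" "s \<le> t" "t \<le> \<tau>"
  shows "norm (incr z s t) \<le> G * \<omega> s t powr (1 / p)"
  using assms \<tau> rough_path_bounds[OF rough_path, of s t] root_control_mono[of 0 s t \<tau>] small
  by (intro \<mu>_bound) auto

lemma error_le_square:
  assumes "0 \<le> s" "s \<le> t" "t \<le> \<tau>"
  shows "L * \<omega> s t powr (3 / p) \<le> (\<omega> s t powr (1 / p))\<^sup>2"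
proof -
  have "L * \<omega> s t powr (1 / p) \<le> L * \<omega> 0 \<tau> powr (1 / p)"
    using assms L by (intro mult_left_mono root_control_mono) auto
  then have "L * \<omega> s t powr (1 / p) \<le> 1" using small by linarith
  then have "(L * \<omega> s t powr (1 / p)) * (\<omega> s t powr (1 / p))\<^sup>2 \<le> 1 * (\<omega> s t powr (1 / p))\<^sup>2"
    by (rule mult_right_mono) simp
  then show ?thesis by (simp add: powr_3_over_p power2_eq_square power3_eq_cube mult_ac)
qed

text \<open>At scales up to 1 the third-order error is absorbed into first order. The bound serves
  twice: it keeps the schemes in the ball and makes their limit continuous.\<close>

lemma increment_bound:
  assumes "a \<in> cball z0 r" "0 \<le> s" "s \<le> t" "t \<le> \<tau>"
    and "norm (b - a - incr a s t) \<le> L * \<omega> s t powr (3 / p)"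
  shows "norm (b - a) \<le> (G + L) * \<omega> s t powr (1 / p)"
proof -
  let ?\<rho> = "\<omega> s t powr (1 / p)"
  have "?\<rho> \<le> 1" using root_control_mono[of 0 s t \<tau>] assms small by auto
  then have "?\<rho> ^ 3 \<le> ?\<rho>" using power_decreasing[of 1 3 ?\<rho>] by simp
  then have "L * \<omega> s t powr (3 / p) \<le> L * ?\<rho>" unfolding powr_3_over_p using L by (intro mult_left_mono)
  then show ?thesis
    using norm_triangle_sub[of "b - a" "incr a s t"] incr_bound[OF assms(1-4)] assms(5)
    by (simp add: distrib_right)
qed

text \<open>Sewing, applied to the deviation from a single Euler step. \<open>Z_in\<close> stops
  before the index \<open>n\<close>, so the estimate is available for proving that the last point
  lies in the ball.\<close>

lemma euler_scheme_bound:
  assumes t: "\<And>i j. i \<le> j \<Longrightarrow> j \<le> n \<Longrightarrow> t i \<le> t j" "0 \<le> t 0" "t n \<le> \<tau>"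
    and Z_Suc: "\<And>i. i < n \<Longrightarrow> Z (Suc i) = Z i + incr (Z i) (t i) (t (Suc i))"
    and Z_in: "\<And>i. i < n \<Longrightarrow> Z i \<in> cball z0 r"
    and ik: "i \<le> k" "k \<le> n"
  shows "norm (Z k - Z i - incr (Z i) (t i) (t k)) \<le> L * \<omega> (t i) (t k) powr (3 / p)"
proof -
  have t': "0 \<le> t i" "t i \<le> \<tau>" "t i \<le> T" if "i \<le> n" for i
    using t(1)[of 0 i] t(1)[of i n] t(2,3) \<tau> that by auto
  define J where "J i k = Z k - Z i - incr (Z i) (t i) (t k)" for i k
  define W where "W i k = \<omega> (t i) (t k)" for i k
  have "norm (J i k) \<le> L * W i k powr (3 / p)"
  proof (rule discrete_sewing[where n = n and C = C])
      show "0 \<le> W i k" if "i \<le> k" "k \<le> n" for i k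
        using that t' t(1) by (auto simp: W_def intro!: control_nonneg[OF control])
      show "W i j + W j k \<le> W i k" if "i \<le> j" "j \<le> k" "k \<le> n" for i j k
        using that t' t(1) control by (auto simp: W_def control_def)
      show "J i i = 0" if "i \<le> n" for i
      proof -
        \<comment> \<open>Chen's relation at three equal times; the Euler step of zero duration
          therefore vanishes.\<close>
        have "\<X> (t i) (t i) = \<X> (t i) (t i) + \<X> (t i) (t i) + tensor 0 0"
          using rough_path t'[OF that] by (fastforce simp: weak_geometric_rough_path_def)
        then have "\<X> (t i) (t i) = 0" by (simp add: tensor_def vec_eq_iff)
        then show ?thesis by (simp add: J_def euler_increment_def)
      qed
      show "J i (Suc i) = 0" if "i < n" for i using Z_Suc[OF that] by (simp add: J_def)
      show "norm (J i k - J i j - J j k) \<le> C * W i k powr (3 / p)"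
        if ijk: "i < j" "j < k" "k \<le> n" and J: "norm (J i j) \<le> L * W i j powr (3 / p)" for i j k
      proof -
        let ?\<rho> = "W i k powr (1 / p)"
        have times: "0 \<le> t i" "t i \<le> t j" "t j \<le> t k" "t k \<le> \<tau>" "t k \<le> T"
          using ijk t' t(1) by auto
        have \<rho>: "0 \<le> ?\<rho>" "?\<rho> \<le> 1" "\<omega> (t i) (t j) powr (1 / p) \<le> ?\<rho>" "\<omega> (t j) (t k) powr (1 / p) \<le> ?\<rho>"
          using times root_control_mono[of 0 "t i" "t k" \<tau>] small(1) by (auto simp: W_def intro!: root_control_mono)
        have sq: "(\<omega> (t i) (t j) powr (1 / p))\<^sup>2 \<le> ?\<rho>\<^sup>2" "(\<omega> (t j) (t k) powr (1 / p))\<^sup>2 \<le> ?\<rho>\<^sup>2"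
          using \<rho> by (auto intro!: power_mono)
        have chen: "\<X> (t i) (t k) = \<X> (t i) (t j) + \<X> (t j) (t k) + tensor (x (t j) - x (t i)) (x (t k) - x (t j))"
          using rough_path times by (auto simp: weak_geometric_rough_path_def)
        \<comment> \<open>Smallness turns the third-order estimate on the left piece into the
          second-order premise of \<open>\<mu>_chen_defect\<close>.\<close>
        have "norm (J i j) \<le> L * \<omega> (t i) (t j) powr (3 / p)" using J by (simp add: W_def)
        also have "\<dots> \<le> (\<omega> (t i) (t j) powr (1 / p))\<^sup>2" using times by (intro error_le_square) auto
        also note sq(1)
        finally have Jij: "norm (Z j - Z i - incr (Z i) (t i) (t j)) \<le> ?\<rho>\<^sup>2" by (simp add: J_def)
        have "norm (incr (Z i) (t i) (t j) + incr (Z j) (t j) (t k) -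
            \<mu> (Z i) ((x (t j) - x (t i)) + (x (t k) - x (t j)))
              (\<X> (t i) (t j) + \<X> (t j) (t k) + tensor (x (t j) - x (t i)) (x (t k) - x (t j)))) \<le> C * ?\<rho> ^ 3"
          using ijk times \<rho> Jij Z_in rough_path_bounds[OF rough_path, of "t i" "t j"]
            rough_path_bounds[OF rough_path, of "t j" "t k"]
          by (intro \<mu>_chen_defect) (auto intro: order_trans[OF _ sq(1)] order_trans[OF _ sq(2)])
        also have "C * ?\<rho> ^ 3 = C * W i k powr (3 / p)" by (simp add: W_def powr_3_over_p)
        finally have "norm (incr (Z i) (t i) (t j) + incr (Z j) (t j) (t k) - incr (Z i) (t i) (t k))
            \<le> C * W i k powr (3 / p)"
          unfolding chen[symmetric] by simp
        moreover have "J i k - J i j - J j k =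
            incr (Z i) (t i) (t j) + incr (Z j) (t j) (t k) - incr (Z i) (t i) (t k)"
          by (simp add: J_def)
        ultimately show ?thesis by simp
      qed
  qed (use p L C_nonneg ik in auto)
  then show ?thesis by (simp add: J_def W_def)
qed

lemma finite_approximation:
  assumes "finite P" "P \<subseteq> {0..\<tau>}"
  obtains z where "z 0 = z0" "\<And>s. z s \<in> cball z0 r"
    "\<And>s t. s \<in> P \<Longrightarrow> t \<in> P \<Longrightarrow> s \<le> t \<Longrightarrow>
      norm (z t - z s - incr (z s) s t) \<le> L * \<omega> s t powr (3 / p)"
proof -
  \<comment> \<open>Time 0 is added as the first grid point; there the scheme starts from
    \<open>z0\<close>.\<close>
  define ts where "ts = sorted_list_of_set (insert 0 P)"
  define n where "n = length ts - 1"
  have set_ts: "set ts = insert 0 P" unfolding ts_def using assms(1) by (intro set_sorted_list_of_set) simp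
  then have len: "length ts = Suc n" by (cases ts) (auto simp: n_def)
  have srt: "sorted ts" by (simp add: ts_def)
  have t_mono: "ts ! i \<le> ts ! j" if "i \<le> j" "j \<le> n" for i j
    using that sorted_nth_mono[OF srt, of i j] len by simp
  have t_mem: "ts ! i \<in> insert 0 P" if "i \<le> n" for i
    using that nth_mem[of i ts] len unfolding set_ts[symmetric] by simp
  have t0: "0 \<le> ts ! 0" and tn: "ts ! n \<le> \<tau>" using t_mem[of 0] t_mem[of n] assms(2) \<tau> by auto
  define Z where "Z = rec_nat z0 (\<lambda>i z. z + incr z (ts ! i) (ts ! Suc i))"
  have Z0: "Z 0 = z0" and Z_Suc: "\<And>i. Z (Suc i) = Z i + incr (Z i) (ts ! i) (ts ! Suc i)"
    by (simp_all add: Z_def)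
  have "0 \<le> (G + L) * \<omega> 0 \<tau> powr (1 / p)" using G_nonneg L by simp
  then have r: "0 \<le> r" using small by linarith
  \<comment> \<open>Once all earlier points are in the ball, the estimate over the whole interval
    from the first grid point bounds the distance from \<open>z0\<close> by the radius, with no
    accumulation over the steps.\<close>
  have Z_in: "Z k \<in> cball z0 r" if "k \<le> n" for k
    using that
  proof (induction k rule: less_induct)
    case (less k)
    have t0k: "ts ! 0 \<le> ts ! k" "ts ! k \<le> \<tau>" using less.prems t_mono[of 0 k] t_mono[of k n] tn by auto
    have "norm (Z k - Z 0 - incr (Z 0) (ts ! 0) (ts ! k)) \<le> L * \<omega> (ts ! 0) (ts ! k) powr (3 / p)"
      using less t_mono t0 t0k Z_Suc by (intro euler_scheme_bound[of k]) auto
    then have "norm (Z k - Z 0) \<le> (G + L) * \<omega> (ts ! 0) (ts ! k) powr (1 / p)"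
      using t0 t0k r by (intro increment_bound) (auto simp: Z0)
    also have "\<dots> \<le> (G + L) * \<omega> 0 \<tau> powr (1 / p)"
      using t0 t0k G_nonneg L by (intro mult_left_mono root_control_mono) auto
    also have "\<dots> \<le> r" by (rule small)
    finally show ?case by (simp add: Z0 dist_norm norm_minus_commute)
  qed
  have Z_bound: "norm (Z k - Z i - incr (Z i) (ts ! i) (ts ! k)) \<le> L * \<omega> (ts ! i) (ts ! k) powr (3 / p)"
    if "i \<le> k" "k \<le> n" for i k
    using that t_mono t0 tn Z_Suc Z_in by (intro euler_scheme_bound[of n]) auto
  define idx where "idx s = (LEAST i. i \<le> n \<and> ts ! i = s)" for s
  have idx: "idx s \<le> n \<and> ts ! idx s = s" if "s \<in> insert 0 P" for s
  proof -
    have "\<exists>i<length ts. ts ! i = s" using that set_ts by (metis in_set_conv_nth)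
    then have "\<exists>i. i \<le> n \<and> ts ! i = s" by (simp add: len less_Suc_eq_le)
    then show ?thesis unfolding idx_def by (rule LeastI_ex)
  qed
  have "ts ! 0 = 0" using t0 idx[of 0] t_mono[of 0 "idx 0"] by auto
  then have idx0: "idx 0 = 0" unfolding idx_def by (intro Least_eq_0) auto
  show ?thesis
  \<comment> \<open>Times off the grid receive the centre of the ball as a default value.\<close>
  proof (rule that[of "\<lambda>s. if s \<in> insert 0 P then Z (idx s) else z0"])
    show "(if 0 \<in> insert 0 P then Z (idx 0) else z0) = z0" by (simp add: idx0 Z0)
    show "(if s \<in> insert 0 P then Z (idx s) else z0) \<in> cball z0 r" for s
      using Z_in idx[of s] r by auto
    fix s t assume st: "s \<in> P" "t \<in> P" "s \<le> t"
    have "idx s \<le> idx t"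
    proof (rule ccontr)
      assume less: "\<not> idx s \<le> idx t"
      then have "t \<le> s" using t_mono[of "idx t" "idx s"] idx[of s] idx[of t] st by auto
      then have "s = t" using st by simp
      with less show False by simp
    qed
    then show "norm ((if t \<in> insert 0 P then Z (idx t) else z0) - (if s \<in> insert 0 P then Z (idx s) else z0) -
       incr (if s \<in> insert 0 P then Z (idx s) else z0) s t) \<le> L * \<omega> s t powr (3 / p)"
      using Z_bound[of "idx s" "idx t"] idx[of s] idx[of t] st by simp
  qed
qed

end

section \<open>Limit of the schemes by compactness\<close>

lemma compact_constraint_satisfaction:
  fixes K :: "'i \<Rightarrow> 'e::t2_space set" and g :: "'i \<Rightarrow> 'i \<Rightarrow> 'e \<Rightarrow> 'e \<Rightarrow> real"
  assumes K: "\<And>i. compact (K i)"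
    and g: "\<And>i j. i \<in> I \<Longrightarrow> j \<in> I \<Longrightarrow> continuous_on (K i \<times> K j) (\<lambda>(a, b). g i j a b)"
    and fin: "\<And>P. finite P \<Longrightarrow> P \<subseteq> I \<Longrightarrow>
      \<exists>z. (\<forall>i. z i \<in> K i) \<and> (\<forall>i\<in>P. \<forall>j\<in>P. g i j (z i) (z j) \<le> 0)"
  shows "\<exists>z. (\<forall>i. z i \<in> K i) \<and> (\<forall>i\<in>I. \<forall>j\<in>I. g i j (z i) (z j) \<le> 0)"
proof -
  define S where "S = PiE UNIV K"
  have "compactin (product_topology (\<lambda>_. euclidean) UNIV) S"
    unfolding S_def compactin_PiE using K by simp
  then have S: "compact S" by (simp add: euclidean_product_topology)
  have "closedin (product_topology (\<lambda>_. euclidean) UNIV) S"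
    unfolding S_def closedin_product_topology using K by (simp add: compact_imp_closed)
  then have S': "closed S" by (simp add: euclidean_product_topology)
  \<comment> \<open>Each condition involves only two coordinates and is therefore closed in the
    product topology, in which \<open>S\<close> is compact by Tychonoff's theorem.\<close>
  define f where "f = (\<lambda>(i, j). {z \<in> S. g i j (z i) (z j) \<le> 0})"
  have "S \<inter> (\<Inter>q\<in>I \<times> I. f q) \<noteq> {}"
  proof (rule compact_imp_fip_image[OF S])
    fix q assume "q \<in> I \<times> I"
    then obtain i j where q: "q = (i, j)" "i \<in> I" "j \<in> I" by auto
    have "continuous_on S (\<lambda>z. (\<lambda>(a, b). g i j a b) (z i, z j))"
      by (rule continuous_on_compose2[OF g[OF q(2,3)]])
         (auto simp: S_def intro!: continuous_intros continuous_on_subset[OF continuous_on_product_coordinates])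
    then have "closed (S \<inter> (\<lambda>z. g i j (z i) (z j)) -` {..0})"
      using S' by (intro continuous_closed_preimage) auto
    moreover have "S \<inter> (\<lambda>z. g i j (z i) (z j)) -` {..0} = f q" by (auto simp: f_def q)
    ultimately show "closed (f q)" by simp
  next
    fix Q assume Q: "finite Q" "Q \<subseteq> I \<times> I"
    \<comment> \<open>Finitely many pairs involve finitely many indices; these form the set to which
      \<open>fin\<close> is applied.\<close>
    then obtain z where z: "\<forall>i. z i \<in> K i"
      "\<forall>i\<in>fst ` Q \<union> snd ` Q. \<forall>j\<in>fst ` Q \<union> snd ` Q. g i j (z i) (z j) \<le> 0"
      using fin[of "fst ` Q \<union> snd ` Q"] by fastforce
    then have "z \<in> S \<inter> (\<Inter>q\<in>Q. f q)" by (force simp: S_def f_def)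
    then show "S \<inter> (\<Inter>q\<in>Q. f q) \<noteq> {}" by blast
  qed
  then obtain z where "z \<in> S" "\<And>i j. i \<in> I \<Longrightarrow> j \<in> I \<Longrightarrow> z \<in> f (i, j)" by blast
  then show ?thesis by (intro exI[of _ z]) (auto simp: S_def f_def)
qed

lemma (in rough_euler) approximation_limit:
  assumes K: "compact (cball z0 r)"
    and \<xi>: "\<And>i. continuous_on (cball z0 r) (\<xi> i)" and \<psi>: "\<And>i j. continuous_on (cball z0 r) (\<psi> i j)"
  obtains z where "z 0 = z0" "\<And>s. z s \<in> cball z0 r"
    "\<And>s t. 0 \<le> s \<Longrightarrow> s \<le> t \<Longrightarrow> t \<le> \<tau> \<Longrightarrow>
      norm (z t - z s - incr (z s) s t) \<le> L * \<omega> s t powr (3 / p)"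
proof -
  \<comment> \<open>Constraints are indexed by all pairs of times; a pair in the wrong order gets a
    trivial one.\<close>
  define g where "g s t a b = (if s \<le> t then norm (b - a - incr a s t) - L * \<omega> s t powr (3 / p) else 0)"
    for s t a b
  \<comment> \<open>The one-point factor at time 0 builds the initial condition into the product.
    Times outside \<open>{0..\<tau>}\<close> are indices too, subject only to membership in their
    factor.\<close>
  define K where "K s = (if s = (0::real) then {z0} else cball z0 r)" for s
  have "0 \<le> (G + L) * \<omega> 0 \<tau> powr (1 / p)" using G_nonneg L by simp
  then have r: "0 \<le> r" using small by linarith
  then have K_sub: "K s \<subseteq> cball z0 r" for s by (auto simp: K_def)
  have "\<exists>z. (\<forall>s. z s \<in> K s) \<and> (\<forall>s\<in>{0..\<tau>}. \<forall>t\<in>{0..\<tau>}. g s t (z s) (z t) \<le> 0)"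
  proof (rule compact_constraint_satisfaction)
    show "compact (K s)" for s using assms(1) by (simp add: K_def)
    have cont: "continuous_on (K s \<times> T) (\<lambda>x. h (fst x))" if "continuous_on (cball z0 r) h"
      for s and T :: "'e set" and h :: "'e \<Rightarrow> 'e"
      using K_sub by (intro continuous_on_compose2[OF that]) (auto intro!: continuous_intros)
    show "continuous_on (K s \<times> K t) (\<lambda>(a, b). g s t a b)" for s t
      unfolding g_def case_prod_unfold euler_increment_def
      by (cases "s \<le> t") (auto intro!: continuous_intros cont \<xi> \<psi>)
    fix P :: "real set" assume "finite P" "P \<subseteq> {0..\<tau>}"
    then obtain z where z: "z 0 = z0" "\<And>s. z s \<in> cball z0 r"
      "\<And>s t. s \<in> P \<Longrightarrow> t \<in> P \<Longrightarrow> s \<le> t \<Longrightarrow>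
        norm (z t - z s - incr (z s) s t) \<le> L * \<omega> s t powr (3 / p)"
      using finite_approximation by metis
    then show "\<exists>z. (\<forall>s. z s \<in> K s) \<and> (\<forall>s\<in>P. \<forall>t\<in>P. g s t (z s) (z t) \<le> 0)"
      by (intro exI[of _ z]) (auto simp: K_def g_def)
  qed
  then obtain z where z: "\<And>s. z s \<in> K s"
    "\<And>s t. s \<in> {0..\<tau>} \<Longrightarrow> t \<in> {0..\<tau>} \<Longrightarrow> g s t (z s) (z t) \<le> 0" by metis
  show ?thesis
  proof (rule that[of z])
    show "z 0 = z0" using z(1)[of 0] by (simp add: K_def)
    show "z s \<in> cball z0 r" for s using z(1)[of s] K_sub[of s] by blast
    show "norm (z t - z s - incr (z s) s t) \<le> L * \<omega> s t powr (3 / p)" if "0 \<le> s" "s \<le> t" "t \<le> \<tau>" for s t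
      using z(2)[of s t] that by (simp add: g_def)
  qed
qed

section \<open>Taylor expansion along the Euler scheme\<close>

text \<open>Takes the maximum of finitely many constants. A nonnegative weight lets a larger
  constant give a weaker bound; including 0 makes the maximum nonnegative.\<close>

lemma uniform_constant:
  fixes u :: "'i::finite \<Rightarrow> 'q \<Rightarrow> real"
  assumes ex: "\<And>i. \<exists>M. \<forall>q\<in>Q. u i q \<le> M * w q" and w: "\<And>q. q \<in> Q \<Longrightarrow> 0 \<le> w q"
  shows "\<exists>M\<ge>0. \<forall>i. \<forall>q\<in>Q. u i q \<le> M * w q"
proof -
  obtain m where m: "\<And>i q. q \<in> Q \<Longrightarrow> u i q \<le> m i * w q" using ex by metis
  show ?thesis
  proof (intro exI[of _ "Max (insert 0 (range m))"] conjI allI ballI)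
    fix i q assume q: "q \<in> Q"
    have "m i \<le> Max (insert 0 (range m))" by (rule Max_ge) auto
    then have "m i * w q \<le> Max (insert 0 (range m)) * w q" using w[OF q] by (rule mult_right_mono)
    with m[OF q, of i] show "u i q \<le> Max (insert 0 (range m)) * w q" by linarith
  qed simp
qed

context finite_coordinates
begin

lemma second_derivative_bound:
  fixes f :: "'e \<Rightarrow> 'b::real_normed_vector"
  assumes "open S" "smooth_on S f" "compact K" "K \<subseteq> S"
  obtains C where "0 \<le> C" "\<And>z u v. z \<in> K \<Longrightarrow> norm (second_derivative f z u v) \<le> C * norm v * norm u"
proof -
  have "\<exists>C\<ge>0. \<forall>z\<in>K. \<forall>u. norm (second_derivative f z u b) \<le> C * norm u" for b
    by (rule derivative_bound[OF smooth_on_frechet_derivative[OF assms(2), of b] assms(3,4)]) blast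
  then obtain C where C: "\<And>b. 0 \<le> C b" "\<And>b z u. z \<in> K \<Longrightarrow> norm (second_derivative f z u b) \<le> C b * norm u"
    by metis
  obtain C' where C': "0 \<le> C'"
    "\<And>v r g. (\<And>b. b \<in> B \<Longrightarrow> norm (g b) \<le> C b * r) \<Longrightarrow>
       norm (\<Sum>b\<in>B. c b v *\<^sub>R (g b :: 'b)) \<le> C' * norm v * r"
    using coordinate_combination_bound[of C] C(1) by metis
  show ?thesis
  proof
    fix z u v assume z: "z \<in> K"
    have "second_derivative f z u v = (\<Sum>b\<in>B. c b v *\<^sub>R second_derivative f z u b)"
      using z assms(4) by (intro second_derivative_expansion[OF assms(1,2)]) auto
    also have "norm \<dots> \<le> C' * norm v * norm u" by (rule C'(2)) (rule C(2)[OF z])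
    finally show "norm (second_derivative f z u v) \<le> C' * norm v * norm u" .
  qed (rule C')
qed

text \<open>The displacement is V + P up to third order, with V of first and P of second order. The
  linear Taylor term sees both, while the quadratic term sees only V: every product involving the
  rest has order at least 3.\<close>

lemma rough_taylor_bound:
  fixes g :: "'e \<Rightarrow> real"
  assumes "open S" "smooth_on S g" "compact K" "convex K" "K \<subseteq> S" and k: "0 \<le> k"
  obtains C where "\<And>a b V P \<rho>. a \<in> K \<Longrightarrow> b \<in> K \<Longrightarrow> 0 \<le> \<rho> \<Longrightarrow> \<rho> \<le> 1 \<Longrightarrow> norm V \<le> k * \<rho> \<Longrightarrow>
    norm P \<le> k * \<rho>\<^sup>2 \<Longrightarrow> norm (b - a - V - P) \<le> k * \<rho>^3 \<Longrightarrow>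
    \<bar>g b - g a - frechet_derivative g (at a) V -
      ((1/2) * second_derivative g a V V + frechet_derivative g (at a) P)\<bar> \<le> C * \<rho>^3"
proof -
  obtain C1 where C1: "0 \<le> C1" "\<And>z v. z \<in> K \<Longrightarrow> norm (frechet_derivative g (at z) v) \<le> C1 * norm v"
    using derivative_bound[OF assms(2,3,5)] by metis
  obtain C2 where C2: "0 \<le> C2" "\<And>z u v. z \<in> K \<Longrightarrow> norm (second_derivative g z u v) \<le> C2 * norm v * norm u"
    using second_derivative_bound[OF assms(1,2,3,5)] by metis
  obtain C3 where C3: "0 \<le> C3" "\<And>x y. x \<in> K \<Longrightarrow> y \<in> K \<Longrightarrow>
    norm (g y - g x - frechet_derivative g (at x) (y - x) -
      (1/2) *\<^sub>R second_derivative g x (y - x) (y - x)) \<le> C3 * (norm (y - x))^3"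
    using taylor_bound_2[OF assms(1-5)] by metis
  show ?thesis
  proof (rule that)
    fix a b V P \<rho>
    assume ab: "a \<in> K" "b \<in> K" and \<rho>: "0 \<le> \<rho>" "\<rho> \<le> 1" and V: "norm V \<le> k * \<rho>"
      and P: "norm P \<le> k * \<rho>\<^sup>2" and J: "norm (b - a - V - P) \<le> k * \<rho>^3"
    define h where "h = b - a"
    define E where "E = h - V"
    let ?D = "frechet_derivative g (at a)" and ?H = "second_derivative g a"
    have aS: "a \<in> S" using ab assms(5) by auto
    note D = smooth_on_linear_derivative[OF assms(2) aS]
    note H = bilinear_second_derivative[OF assms(1,2) aS]
    have pw: "\<rho>^3 \<le> \<rho>\<^sup>2" "\<rho>\<^sup>2 \<le> \<rho>"
      using power_decreasing[of 2 3 \<rho>] power_decreasing[of 1 2 \<rho>] \<rho> by auto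
    have kpw: "k * \<rho>^3 \<le> k * \<rho>\<^sup>2" "k * \<rho>\<^sup>2 \<le> k * \<rho>" using pw k by (auto intro: mult_left_mono)
    have E: "norm E \<le> 2 * k * \<rho>\<^sup>2"
      using norm_triangle_ineq[of "b - a - V - P" P] J P kpw by (simp add: E_def h_def)
    then have h: "norm h \<le> 3 * k * \<rho>" using norm_triangle_ineq[of E V] V kpw by (simp add: E_def)
    have T: "\<bar>g b - g a - ?D h - (1/2) * ?H h h\<bar> \<le> C3 * (3 * k * \<rho>)^3"
    proof -
      have "\<bar>g b - g a - ?D h - (1/2) * ?H h h\<bar> \<le> C3 * (norm h)^3" using C3(2)[OF ab] by (simp add: h_def)
      also have "\<dots> \<le> C3 * (3 * k * \<rho>)^3" using h C3(1) by (intro mult_left_mono power_mono) auto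
      finally show ?thesis .
    qed
    have "?D (h - V - P) = ?D h - ?D V - ?D P" by (simp add: linear_diff[OF D])
    moreover have "\<bar>?D (h - V - P)\<bar> \<le> C1 * (k * \<rho>^3)"
    proof -
      have "\<bar>?D (h - V - P)\<bar> \<le> C1 * norm (h - V - P)" using C1(2)[OF ab(1)] by simp
      also have "\<dots> \<le> C1 * (k * \<rho>^3)" using J C1(1) by (intro mult_left_mono) (auto simp: h_def)
      finally show ?thesis .
    qed
    ultimately have DJ: "\<bar>?D h - ?D V - ?D P\<bar> \<le> C1 * (k * \<rho>^3)" by simp
    \<comment> \<open>Replacing one argument at a time leaves two terms, each with one factor
      \<open>E\<close> of order 2 and one factor of order 1.\<close>
    have "?H h h = ?H (E + V) h" by (simp add: E_def)
    also have "\<dots> = ?H E h + ?H V h" by (rule bilinear_ladd[OF H])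
    also have "?H V h = ?H V (E + V)" by (simp add: E_def)
    also have "\<dots> = ?H V E + ?H V V" by (rule bilinear_radd[OF H])
    finally have Hh: "?H h h - ?H V V = ?H E h + ?H V E" by simp
    have "\<bar>?H E h\<bar> \<le> C2 * (3 * k * \<rho>) * (2 * k * \<rho>\<^sup>2)"
    proof -
      have "\<bar>?H E h\<bar> \<le> C2 * norm h * norm E" using C2(2)[OF ab(1)] by simp
      also have "\<dots> \<le> C2 * (3 * k * \<rho>) * (2 * k * \<rho>\<^sup>2)"
        using h E C2(1) k \<rho> by (intro mult_mono mult_left_mono) auto
      finally show ?thesis .
    qed
    moreover have "\<bar>?H V E\<bar> \<le> C2 * (2 * k * \<rho>\<^sup>2) * (k * \<rho>)"
    proof -
      have "\<bar>?H V E\<bar> \<le> C2 * norm E * norm V" using C2(2)[OF ab(1)] by simp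
      also have "\<dots> \<le> C2 * (2 * k * \<rho>\<^sup>2) * (k * \<rho>)"
        using V E C2(1) k \<rho> by (intro mult_mono mult_left_mono) auto
      finally show ?thesis .
    qed
    ultimately have HV: "\<bar>?H h h - ?H V V\<bar> \<le> C2 * (3 * k * \<rho>) * (2 * k * \<rho>\<^sup>2) + C2 * (2 * k * \<rho>\<^sup>2) * (k * \<rho>)"
      unfolding Hh by linarith

    have combine: "\<bar>u - d2 - ((1/2) * q2 + d3)\<bar> \<le> e1 + e2 + (1/2) * e3"
      if "\<bar>u - d1 - (1/2) * q1\<bar> \<le> e1" "\<bar>d1 - d2 - d3\<bar> \<le> e2" "\<bar>q1 - q2\<bar> \<le> e3"
      for u d1 d2 d3 q1 q2 e1 e2 e3 :: real using that by linarith
    have "\<bar>g b - g a - ?D V - ((1/2) * ?H V V + ?D P)\<bar> \<le> C3 * (3 * k * \<rho>)^3 + C1 * (k * \<rho>^3) +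
       (1/2) * (C2 * (3 * k * \<rho>) * (2 * k * \<rho>\<^sup>2) + C2 * (2 * k * \<rho>\<^sup>2) * (k * \<rho>))"
      by (rule combine[OF T DJ HV])
    also have "\<dots> = (27 * C3 * k^3 + C1 * k + 4 * C2 * k\<^sup>2) * \<rho>^3"
      by (simp add: power2_eq_square power3_eq_cube algebra_simps)
    finally show "\<bar>g b - g a - ?D V - ((1/2) * ?H V V + ?D P)\<bar> \<le> (27 * C3 * k^3 + C1 * k + 4 * C2 * k\<^sup>2) * \<rho>^3" .
  qed
qed

text \<open>Compactness, Taylor and mean value estimates give a constant for each index and each of
  five kinds of bound. Maxima over the finite index types and a sum over the kinds combine
  them.\<close>

lemma euler_fields_exist:
  fixes \<xi> :: "'k::finite \<Rightarrow> 'e \<Rightarrow> 'e"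
  assumes "open S" "\<And>i. smooth_on S (\<xi> i)" "compact K" "convex K" "K \<subseteq> S"
  shows "\<exists>M. euler_fields K \<xi> (\<lambda>i j z. frechet_derivative (\<xi> j) (at z) (\<xi> i z))
    (\<lambda>i z. frechet_derivative (\<xi> i) (at z)) M"
proof -
  let ?\<psi> = "\<lambda>i j z. frechet_derivative (\<xi> j) (at z) (\<xi> i z)"
  have \<psi>: "smooth_on S (?\<psi> i j)" for i j by (intro smooth_on_derivative_along assms)
  have bdd: "\<exists>M. \<forall>z\<in>K. norm (f z) \<le> M" if "smooth_on S f" for f :: "'e \<Rightarrow> 'e"
  proof -
    have "compact (f ` K)" using assms(3,5) smooth_on_continuous_on[OF that]
      by (intro compact_continuous_image) (auto intro: continuous_on_subset)
    then have "bounded (f ` K)" by (rule compact_imp_bounded)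
    then show ?thesis by (auto simp: bounded_iff)
  qed
  have "\<exists>M\<ge>0. \<forall>i. \<forall>z\<in>K. norm (\<xi> i z) \<le> M * 1"
  proof (rule uniform_constant)
    show "\<exists>M. \<forall>z\<in>K. norm (\<xi> i z) \<le> M * 1" for i using bdd[OF assms(2)] by simp
  qed simp
  then obtain m1 where m1: "0 \<le> m1" "\<And>i z. z \<in> K \<Longrightarrow> norm (\<xi> i z) \<le> m1 * 1" by blast
  have "\<exists>M\<ge>0. \<forall>q. \<forall>z\<in>K. norm (?\<psi> (fst q) (snd q) z) \<le> M * 1"
  proof (rule uniform_constant)
    show "\<exists>M. \<forall>z\<in>K. norm (?\<psi> (fst q) (snd q) z) \<le> M * 1" for q using bdd[OF \<psi>] by simp
  qed simp
  then obtain m2 where m2: "0 \<le> m2" "\<And>q z. z \<in> K \<Longrightarrow> norm (?\<psi> (fst q) (snd q) z) \<le> m2 * 1" by blast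
  have "\<exists>M\<ge>0. \<forall>i. \<forall>q\<in>K \<times> UNIV. norm (frechet_derivative (\<xi> i) (at (fst q)) (snd q)) \<le> M * norm (snd q)"
  proof (rule uniform_constant)
    show "\<exists>M. \<forall>q\<in>K \<times> UNIV. norm (frechet_derivative (\<xi> i) (at (fst q)) (snd q)) \<le> M * norm (snd q)" for i
      by (rule derivative_bound[OF assms(2) assms(3,5), of i]) auto
  qed simp
  then obtain m3 where m3: "0 \<le> m3" "\<And>i q. q \<in> K \<times> UNIV \<Longrightarrow>
      norm (frechet_derivative (\<xi> i) (at (fst q)) (snd q)) \<le> m3 * norm (snd q)" by blast
  have "\<exists>M\<ge>0. \<forall>i. \<forall>q\<in>K \<times> K. norm (\<xi> i (snd q) - \<xi> i (fst q) - frechet_derivative (\<xi> i) (at (fst q)) (snd q - fst q))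
        \<le> M * (norm (snd q - fst q))\<^sup>2"
  proof (rule uniform_constant)
    show "\<exists>M. \<forall>q\<in>K \<times> K.
      norm (\<xi> i (snd q) - \<xi> i (fst q) - frechet_derivative (\<xi> i) (at (fst q)) (snd q - fst q))
        \<le> M * (norm (snd q - fst q))\<^sup>2" for i
      by (rule taylor_bound_1[OF assms(2) assms(3-5), of i]) auto
  qed simp
  then obtain m4 where m4: "0 \<le> m4" "\<And>i q. q \<in> K \<times> K \<Longrightarrow>
      norm (\<xi> i (snd q) - \<xi> i (fst q) - frechet_derivative (\<xi> i) (at (fst q)) (snd q - fst q))
        \<le> m4 * (norm (snd q - fst q))\<^sup>2" by blast
  have "\<exists>M\<ge>0. \<forall>i. \<forall>q\<in>K \<times> K. norm (?\<psi> (fst i) (snd i) (snd q) - ?\<psi> (fst i) (snd i) (fst q)) \<le> M * norm (snd q - fst q)"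
  proof (rule uniform_constant)
    show "\<exists>M. \<forall>q\<in>K \<times> K.
      norm (?\<psi> (fst i) (snd i) (snd q) - ?\<psi> (fst i) (snd i) (fst q)) \<le> M * norm (snd q - fst q)" for i
      by (rule lipschitz_bound[OF \<psi> assms(3-5), of "snd i" "fst i"]) auto
  qed simp
  then obtain m5 where m5: "0 \<le> m5" "\<And>i q. q \<in> K \<times> K \<Longrightarrow>
      norm (?\<psi> (fst i) (snd i) (snd q) - ?\<psi> (fst i) (snd i) (fst q)) \<le> m5 * norm (snd q - fst q)" by blast
  have mono: "u \<le> M' * w" if "u \<le> M * w" "M \<le> M'" "0 \<le> w" for u w M M' :: real
    using that mult_right_mono[of M M' w] by linarith
  define M where "M = m1 + m2 + m3 + m4 + m5"
  have M: "0 \<le> M" "m1 \<le> M" "m2 \<le> M" "m3 \<le> M" "m4 \<le> M" "m5 \<le> M"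
    using m1(1) m2(1) m3(1) m4(1) m5(1) by (auto simp: M_def)
  show ?thesis
  proof (rule exI[of _ M], rule euler_fields.intro)
    show "norm (\<xi> i z) \<le> M" if "z \<in> K" for i z using m1(2)[OF that, of i] M by simp
    show "norm (?\<psi> i j z) \<le> M" if "z \<in> K" for i j z using m2(2)[OF that, of "(i, j)"] M by simp
    show "linear (frechet_derivative (\<xi> i) (at z))" if "z \<in> K" for i z
      using that assms(5) by (intro smooth_on_linear_derivative[OF assms(2)]) auto
    show "norm (frechet_derivative (\<xi> i) (at z) v) \<le> M * norm v" if "z \<in> K" for i z v
      by (rule mono[of _ m3]) (use m3(2)[of "(z, v)" i] that M(4) in auto)
    show "norm (\<xi> i b - \<xi> i a - frechet_derivative (\<xi> i) (at a) (b - a)) \<le> M * (norm (b - a))\<^sup>2"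
      if "a \<in> K" "b \<in> K" for i a b
      by (rule mono[of _ m4]) (use m4(2)[of "(a, b)" i] that M(5) in auto)
    show "norm (?\<psi> i j b - ?\<psi> i j a) \<le> M * norm (b - a)" if "a \<in> K" "b \<in> K" for i j a b
      by (rule mono[of _ m5]) (use m5(2)[of "(a, b)" "(i, j)"] that M(6) in auto)
  qed (use M in auto)
qed

end

text \<open>Averaging the sum with its copy in which the indices are exchanged replaces
  \<open>W\<close> by its symmetric part.\<close>

lemma matrix_sum_symmetric_part:
  fixes W :: "real^'k^'k"
  assumes sym: "\<And>i j. h i j = (h j i :: real)" and W: "W + transpose W = tensor v v"
  shows "(\<Sum>i\<in>UNIV. \<Sum>j\<in>UNIV. W $ i $ j * h i j) = (1/2) * (\<Sum>i\<in>UNIV. \<Sum>j\<in>UNIV. v $ i * v $ j * h i j)"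
proof -
  have "(\<Sum>i\<in>UNIV. \<Sum>j\<in>UNIV. W $ i $ j * h i j) = (\<Sum>i\<in>UNIV. \<Sum>j\<in>UNIV. W $ j $ i * h i j)"
    by (subst sum.swap) (simp add: sym)
  then have "2 * (\<Sum>i\<in>UNIV. \<Sum>j\<in>UNIV. W $ i $ j * h i j) =
      (\<Sum>i\<in>UNIV. \<Sum>j\<in>UNIV. (W $ i $ j + W $ j $ i) * h i j)"
    by (simp add: distrib_right sum.distrib)
  moreover have "W $ i $ j + W $ j $ i = v $ i * v $ j" for i j
    using arg_cong[OF W, of "\<lambda>A. A $ i $ j"] by (simp add: transpose_def tensor_def)
  ultimately show ?thesis by simp
qed

section \<open>Vector fields in charts\<close>

lemma chart_facts:
  assumes "is_chart M (U, \<phi>)"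
  shows "openin M U" "open (\<phi> ` U)" "inj_on \<phi> U"
    "continuous_map (subtopology M U) euclidean \<phi>"
    "continuous_map (top_of_set (\<phi> ` U)) M (inv_into U \<phi>)"
proof -
  have h: "homeomorphic_map (subtopology M U) (top_of_set (\<phi> ` U)) \<phi>"
    using assms by (simp add: is_chart_def)
  show oU: "openin M U" and "open (\<phi> ` U)" using assms by (auto simp: is_chart_def)
  have top: "topspace (subtopology M U) = U" using openin_subset[OF oU] by auto
  show inj: "inj_on \<phi> U" using homeomorphic_imp_injective_map[OF h] unfolding top .
  show "continuous_map (subtopology M U) euclidean \<phi>"
    using homeomorphic_imp_continuous_map[OF h] continuous_map_in_subtopology by blast
  obtain g where g: "homeomorphic_maps (subtopology M U) (top_of_set (\<phi> ` U)) \<phi> g"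
    using h by (auto simp: homeomorphic_map_maps)
  have "continuous_map (top_of_set (\<phi> ` U)) M g"
    using g continuous_map_in_subtopology by (auto simp: homeomorphic_maps_def)
  moreover have "g z = inv_into U \<phi> z" if "z \<in> \<phi> ` U" for z
    using g inj that unfolding homeomorphic_maps_def top by (auto simp: inv_into_f_f)
  ultimately show "continuous_map (top_of_set (\<phi> ` U)) M (inv_into U \<phi>)"
    by (auto intro: continuous_map_eq)
qed

lemma smooth_functions_chart:
  "f \<in> smooth_functions A \<Longrightarrow> (U, \<phi>) \<in> A \<Longrightarrow> smooth_on (\<phi> ` U) (f \<circ> inv_into U \<phi>)"
  by (auto simp: smooth_functions_def)

text \<open>Coefficient fields are chosen for the axis vectors only and extended through linearity
  of \<open>F\<close>, so that linear dependence on w holds by construction.\<close>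

lemma field_coordinates:
  fixes F :: "real^'k \<Rightarrow> 'm \<Rightarrow> 'm tangent_vector" and A :: "('m, 'e::real_normed_vector) chart set"
  assumes F: "linear_into_fields M A F" and U: "(U, \<phi>) \<in> A" "is_chart M (U, \<phi>)"
  obtains \<xi> :: "'k \<Rightarrow> 'e \<Rightarrow> 'e" where "\<And>i. smooth_on (\<phi> ` U) (\<xi> i)"
    "\<And>q f w. q \<in> U \<Longrightarrow> f \<in> smooth_functions A \<Longrightarrow>
      F w q f = chart_vector (U, \<phi>) q (\<Sum>i\<in>UNIV. w $ i *\<^sub>R \<xi> i (\<phi> q)) f"
proof -
  have "\<forall>i. \<exists>\<xi>. smooth_on (\<phi> ` U) \<xi> \<and>
      (\<forall>q\<in>U. \<forall>f\<in>smooth_functions A. F (axis i 1) q f = chart_vector (U, \<phi>) q (\<xi> (\<phi> q)) f)"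
    using F U(1) unfolding linear_into_fields_def smooth_vector_fields_def by blast
  from choice[OF this] obtain \<xi> :: "'k \<Rightarrow> 'e \<Rightarrow> 'e" where \<xi>: "\<And>i. smooth_on (\<phi> ` U) (\<xi> i)"
    "\<And>i q f. q \<in> U \<Longrightarrow> f \<in> smooth_functions A \<Longrightarrow>
      F (axis i 1) q f = chart_vector (U, \<phi>) q (\<xi> i (\<phi> q)) f" by blast
  have "F w q f = chart_vector (U, \<phi>) q (\<Sum>i\<in>UNIV. w $ i *\<^sub>R \<xi> i (\<phi> q)) f"
    if q: "q \<in> U" and f: "f \<in> smooth_functions A" for q f w
  proof -
    have "q \<in> topspace M" using q openin_subset[OF chart_facts(1)[OF U(2)]] by auto
    then have lin: "linear (\<lambda>w. F w q f)" using F by (simp add: linear_into_fields_def)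
    have lin': "linear (frechet_derivative (f \<circ> inv_into U \<phi>) (at (\<phi> q)))"
      using q by (intro smooth_on_linear_derivative[OF smooth_functions_chart[OF f U(1)]]) auto
    have "F w q f = F (\<Sum>i\<in>UNIV. w $ i *\<^sub>R axis i 1) q f"
      using basis_expansion[of w] by (simp add: scalar_mult_eq_scaleR)
    also have "\<dots> = (\<Sum>i\<in>UNIV. w $ i *\<^sub>R F (axis i 1) q f)"
      by (simp only: linear_sum[OF lin] linear_scale[OF lin])
    also have "\<dots> = (\<Sum>i\<in>UNIV. w $ i *\<^sub>R chart_vector (U, \<phi>) q (\<xi> i (\<phi> q)) f)"
      using \<xi>(2)[OF q f] by simp
    also have "\<dots> = chart_vector (U, \<phi>) q (\<Sum>i\<in>UNIV. w $ i *\<^sub>R \<xi> i (\<phi> q)) f"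
      by (simp only: chart_vector_def prod.case linear_sum[OF lin'] linear_scale[OF lin'])
    finally show ?thesis .
  qed
  with \<xi>(1) show ?thesis by (rule that)
qed

text \<open>Serves the iterated derivative: the chart representation of a field is available on
  \<open>smooth_functions A\<close>, and this puts the once differentiated function there.\<close>

lemma (in finite_coordinates) apply_field_smooth:
  fixes F :: "real^'k \<Rightarrow> 'm \<Rightarrow> 'm tangent_vector" and A :: "('m, 'e) chart set"
  assumes F: "linear_into_fields M A F" and chart: "\<And>c. c \<in> A \<Longrightarrow> is_chart M c"
    and f: "f \<in> smooth_functions A"
  shows "apply_field (F w) f \<in> smooth_functions A"
  unfolding smooth_functions_def
proof (clarify)
  fix U :: "'m set" and \<phi> :: "'m \<Rightarrow> 'e" assume U: "(U, \<phi>) \<in> A"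
  note cf = chart_facts[OF chart[OF U]]
  have "\<exists>\<xi>. smooth_on (\<phi> ` U) \<xi> \<and>
      (\<forall>q\<in>U. \<forall>f\<in>smooth_functions A. F w q f = chart_vector (U, \<phi>) q (\<xi> (\<phi> q)) f)"
    using F U unfolding linear_into_fields_def smooth_vector_fields_def by blast
  then obtain \<xi> where \<xi>: "smooth_on (\<phi> ` U) \<xi>"
     "\<And>q f. q \<in> U \<Longrightarrow> f \<in> smooth_functions A \<Longrightarrow> F w q f = chart_vector (U, \<phi>) q (\<xi> (\<phi> q)) f"
    by metis
  show "smooth_on (\<phi> ` U) (apply_field (F w) f \<circ> inv_into U \<phi>)"
  proof (rule smooth_on_cong[OF cf(2)])
    show "smooth_on (\<phi> ` U) (\<lambda>z. frechet_derivative (f \<circ> inv_into U \<phi>) (at z) (\<xi> z))"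
      by (intro smooth_on_derivative_along cf \<xi> smooth_functions_chart[OF f U])
    show "frechet_derivative (f \<circ> inv_into U \<phi>) (at z) (\<xi> z) = (apply_field (F w) f \<circ> inv_into U \<phi>) z"
      if "z \<in> \<phi> ` U" for z
      using that cf(3) by (auto simp: apply_field_def \<xi>(2)[OF _ f] chart_vector_def)
  qed
qed

text \<open>Each summand is the rank-one operator that multiplies \<open>a i s\<close> by the i-th
  component; as a composition of bounded maps it depends continuously on \<open>a i s\<close> in
  operator norm.\<close>

lemma blinfun_of_columns:
  fixes a :: "'k::finite \<Rightarrow> 's::topological_space \<Rightarrow> 'e::real_normed_vector"
  assumes "\<And>i. continuous_on S (a i)"
  shows "\<exists>\<eta> :: 's \<Rightarrow> (real^'k) \<Rightarrow>\<^sub>L 'e. continuous_on S \<eta> \<and>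
    (\<forall>s w. blinfun_apply (\<eta> s) w = (\<Sum>i\<in>UNIV. w $ i *\<^sub>R a i s))"
proof (intro exI[of _ "\<lambda>s. \<Sum>i\<in>UNIV. blinfun_scaleR_left (a i s) o\<^sub>L blinfun_inner_left (axis i 1)"] conjI allI)
  show "continuous_on S (\<lambda>s. \<Sum>i\<in>UNIV. blinfun_scaleR_left (a i s) o\<^sub>L blinfun_inner_left (axis i 1))"
    by (intro continuous_on_sum bounded_bilinear.continuous_on[OF bounded_bilinear_blinfun_compose]
        bounded_linear.continuous_on[OF bounded_linear_blinfun_scaleR_left] assms continuous_on_const)
qed (simp add: blinfun.sum_left inner_axis)

text \<open>In each chart the required operator has the columns
  \<open>\<xi> i (\<phi> (y s))\<close>, which are continuous in s.\<close>

lemma continuous_along_fields: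
  fixes F :: "real^'k \<Rightarrow> 'm \<Rightarrow> 'm tangent_vector" and A :: "('m, 'e::real_normed_vector) chart set"
  assumes F: "linear_into_fields M A F" and chart: "\<And>c. c \<in> A \<Longrightarrow> is_chart M c"
    and y: "continuous_map (top_of_set I0) M y"
  shows "continuous_along A I0 y (\<lambda>s w. F w (y s))"
  unfolding continuous_along_def
proof clarify
  fix U and \<phi> :: "'m \<Rightarrow> 'e" assume U: "(U, \<phi>) \<in> A"
  note cf = chart_facts[OF chart[OF U]]
  obtain \<xi> :: "'k \<Rightarrow> 'e \<Rightarrow> 'e" where \<xi>: "\<And>i. smooth_on (\<phi> ` U) (\<xi> i)"
    "\<And>q f w. q \<in> U \<Longrightarrow> f \<in> smooth_functions A \<Longrightarrow>
      F w q f = chart_vector (U, \<phi>) q (\<Sum>i\<in>UNIV. w $ i *\<^sub>R \<xi> i (\<phi> q)) f"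
    using field_coordinates[OF F U chart[OF U]] by blast
  let ?S = "{s \<in> I0. y s \<in> U}"
  have "continuous_map (top_of_set ?S) M y"
    using continuous_map_from_subtopology_mono[OF y, of ?S] by auto
  then have "continuous_map (top_of_set ?S) (subtopology M U) y"
    by (auto simp: continuous_map_in_subtopology)
  from continuous_map_compose[OF this cf(4)] have "continuous_on ?S (\<phi> \<circ> y)" by simp
  then have cont: "continuous_on ?S (\<lambda>s. \<xi> i (\<phi> (y s)))" for i
    by (intro continuous_on_compose2[OF smooth_on_continuous_on[OF \<xi>(1)[of i]], of ?S "\<lambda>s. \<phi> (y s)"])
       (auto simp: o_def)
  obtain \<eta> :: "real \<Rightarrow> (real^'k) \<Rightarrow>\<^sub>L 'e" where "continuous_on ?S \<eta>"
    "\<And>s w. blinfun_apply (\<eta> s) w = (\<Sum>i\<in>UNIV. w $ i *\<^sub>R \<xi> i (\<phi> (y s)))"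
    using blinfun_of_columns[of ?S "\<lambda>i s. \<xi> i (\<phi> (y s))", OF cont] by blast
  then show "\<exists>\<eta>. continuous_on ?S \<eta> \<and> (\<forall>s\<in>I0. y s \<in> U \<longrightarrow> (\<forall>w. \<forall>f\<in>smooth_functions A.
      F w (y s) f = chart_vector (U, \<phi>) (y s) (blinfun_apply (\<eta> s) w) f))"
    using \<xi>(2) by (intro exI[of _ \<eta>]) auto
qed

section \<open>Short times and continuity of controlled paths\<close>

lemma control_small:
  assumes "0 < T" "control T \<omega>" "0 < \<epsilon>" "0 < p"
  obtains \<tau> where "0 < \<tau>" "\<tau> \<le> T" "\<omega> 0 \<tau> powr (1 / p) \<le> \<epsilon>"
proof -
  have "continuous_on {0..T} (\<lambda>t. (\<lambda>(s, t). \<omega> s t) (0, t))"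
    by (rule continuous_on_compose2[of "simplex2 T" "\<lambda>(s, t). \<omega> s t" _ "\<lambda>t. (0, t)"])
       (use assms(2) in \<open>auto intro!: continuous_intros simp: simplex2_def control_def\<close>)
  then have "continuous_on {0..T} (\<omega> 0)" by simp
  moreover have "0 < \<epsilon> powr p" "0 \<in> {0..T}" using assms by auto
  ultimately obtain d where d: "0 < d" "\<And>t. t \<in> {0..T} \<Longrightarrow> dist t 0 < d \<Longrightarrow> dist (\<omega> 0 t) (\<omega> 0 0) < \<epsilon> powr p"
    unfolding continuous_on_iff by meson
  \<comment> \<open>Halving \<open>d\<close> provides the strict inequality that continuity at 0
    asks for.\<close>
  define \<tau> where "\<tau> = min T (d / 2)"
  have \<tau>: "0 < \<tau>" "\<tau> \<le> T" "\<tau> < d" using assms d(1) by (auto simp: \<tau>_def)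
  have "\<omega> 0 0 = 0" using assms by (simp add: control_def)
  then have "\<omega> 0 \<tau> \<le> \<epsilon> powr p" using d(2)[of \<tau>] \<tau> by (auto simp: dist_real_def)
  then have "\<omega> 0 \<tau> powr (1 / p) \<le> (\<epsilon> powr p) powr (1 / p)"
    using control_nonneg[OF assms(2), of 0 \<tau>] \<tau> assms(4) by (intro powr_mono2) auto
  also have "\<dots> = \<epsilon>" using assms by (simp add: powr_powr)
  finally show ?thesis using \<tau> by (intro that)
qed

lemma continuous_on_if_control_bound:
  fixes z :: "real \<Rightarrow> 'e::real_normed_vector"
  assumes \<omega>: "control T \<omega>" and \<tau>: "\<tau> \<le> T" and p: "0 < p"
    and z: "\<And>s t. 0 \<le> s \<Longrightarrow> s \<le> t \<Longrightarrow> t \<le> \<tau> \<Longrightarrow> norm (z t - z s) \<le> c * \<omega> s t powr (1 / p)"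
  shows "continuous_on {0..\<tau>} z"
  unfolding continuous_on_def
proof
  fix s0 assume s0: "s0 \<in> {0..\<tau>}"
  \<comment> \<open>\<open>min\<close> and \<open>max\<close> treat times on both sides of
    \<open>s0\<close> at once; \<open>h\<close> dominates the increment from \<open>s0\<close> and
    tends to 0 there.\<close>
  define h where "h s = c * \<omega> (min s s0) (max s s0) powr (1 / p)" for s
  have "continuous_on {0..\<tau>} (\<lambda>s. (\<lambda>(s, t). \<omega> s t) (min s s0, max s s0))"
    by (rule continuous_on_compose2[of "simplex2 T" "\<lambda>(s, t). \<omega> s t" _ "\<lambda>s. (min s s0, max s s0)"])
       (use \<omega> s0 \<tau> in \<open>auto intro!: continuous_intros simp: simplex2_def control_def\<close>)
  then have "continuous_on {0..\<tau>} h"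
    unfolding h_def using \<omega> s0 \<tau> p
    by (intro continuous_intros continuous_on_powr') (auto intro!: control_nonneg[OF \<omega>])
  then have "(h \<longlongrightarrow> h s0) (at s0 within {0..\<tau>})" using s0 by (simp add: continuous_on_def)
  moreover have "h s0 = 0" using \<omega> s0 \<tau> by (simp add: h_def control_def)
  ultimately have h: "(h \<longlongrightarrow> 0) (at s0 within {0..\<tau>})" by simp
  have "norm (z s - z s0) \<le> h s" if "s \<in> {0..\<tau>}" for s
    using z[of s s0] z[of s0 s] that s0 by (cases "s \<le> s0") (auto simp: h_def norm_minus_commute)
  then have "((\<lambda>s. z s - z s0) \<longlongrightarrow> 0) (at s0 within {0..\<tau>})"
    by (intro Lim_null_comparison[OF _ h]) (auto simp: eventually_at_filter)
  then show "(z \<longlongrightarrow> z s0) (at s0 within {0..\<tau>})" by (rule LIM_zero_cancel)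
qed

text \<open>The product rule splits the iterated derivative. Its second-derivative part is symmetric
  in i and j, so it meets only the symmetric part of \<open>W\<close> and becomes a quadratic form
  in \<open>v\<close>; the other part is linear in \<open>W\<close> and can be pulled inside the
  first derivative of \<open>g\<close>.\<close>

lemma (in finite_coordinates) second_order_term:
  fixes g :: "'e \<Rightarrow> real" and \<xi> :: "'k::finite \<Rightarrow> 'e \<Rightarrow> 'e" and W :: "real^'k^'k"
  assumes S: "open S" "z \<in> S" and g: "smooth_on S g" and \<xi>: "\<And>i. smooth_on S (\<xi> i)"
    and W: "W + transpose W = tensor v v"
  shows "(\<Sum>i\<in>UNIV. \<Sum>j\<in>UNIV.
      W $ i $ j * frechet_derivative (\<lambda>z. frechet_derivative g (at z) (\<xi> j z)) (at z) (\<xi> i z)) =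
    (1/2) * second_derivative g z (\<Sum>i\<in>UNIV. v $ i *\<^sub>R \<xi> i z) (\<Sum>i\<in>UNIV. v $ i *\<^sub>R \<xi> i z) +
    frechet_derivative g (at z)
      (\<Sum>i\<in>UNIV. \<Sum>j\<in>UNIV. W $ i $ j *\<^sub>R frechet_derivative (\<xi> j) (at z) (\<xi> i z))"
proof -
  let ?H = "second_derivative g z" and ?D = "frechet_derivative g (at z)"
  note H = bilinear_second_derivative[OF S(1) g S(2)]
  note D = smooth_on_linear_derivative[OF g S(2)]
  have "?H (\<Sum>i\<in>UNIV. v $ i *\<^sub>R \<xi> i z) (\<Sum>i\<in>UNIV. v $ i *\<^sub>R \<xi> i z) =
      (\<Sum>(i, j)\<in>UNIV \<times> UNIV. ?H (v $ i *\<^sub>R \<xi> i z) (v $ j *\<^sub>R \<xi> j z))"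
    by (rule bilinear_sum[OF H])
  also have "\<dots> = (\<Sum>i\<in>UNIV. \<Sum>j\<in>UNIV. v $ i * v $ j * ?H (\<xi> i z) (\<xi> j z))"
    unfolding sum.cartesian_product
    by (intro sum.cong) (auto simp: bilinear_lmul[OF H] bilinear_rmul[OF H])
  finally have "(1/2) * ?H (\<Sum>i\<in>UNIV. v $ i *\<^sub>R \<xi> i z) (\<Sum>i\<in>UNIV. v $ i *\<^sub>R \<xi> i z) =
      (\<Sum>i\<in>UNIV. \<Sum>j\<in>UNIV. W $ i $ j * ?H (\<xi> i z) (\<xi> j z))"
    using matrix_sum_symmetric_part[of "\<lambda>i j. ?H (\<xi> i z) (\<xi> j z)", OF second_derivative_symmetric[OF S(1) g S(2)] W]
    by simp
  moreover have "?D (\<Sum>i\<in>UNIV. \<Sum>j\<in>UNIV. W $ i $ j *\<^sub>R frechet_derivative (\<xi> j) (at z) (\<xi> i z)) =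
      (\<Sum>i\<in>UNIV. \<Sum>j\<in>UNIV. W $ i $ j * ?D (frechet_derivative (\<xi> j) (at z) (\<xi> i z)))"
    by (simp add: linear_sum[OF D] linear_scale[OF D])
  moreover have "frechet_derivative (\<lambda>z. frechet_derivative g (at z) (\<xi> j z)) (at z) (\<xi> i z) =
      ?H (\<xi> i z) (\<xi> j z) + ?D (frechet_derivative (\<xi> j) (at z) (\<xi> i z))" for i j
    by (rule derivative_derivative_along[OF S(1) g \<xi> S(2)])
  ultimately show ?thesis by (simp only: distrib_left sum.distrib)
qed

lemma axis_combination: "(\<Sum>i\<in>UNIV. axis j 1 $ i *\<^sub>R a i) = (a j :: 'e::real_vector)"
  for j :: "'k::finite"
proof -
  have "(\<Sum>i\<in>UNIV. axis j (1::real) $ i *\<^sub>R a i) = (\<Sum>i\<in>UNIV. if j = i then a i else 0)"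
    by (intro sum.cong) (auto simp: axis_def)
  then show ?thesis by simp
qed

theorem theorem5p4:
  fixes M :: "'m topology"
    and A :: "('m, 'e::real_normed_vector) chart set"
    and F :: "real^'k \<Rightarrow> 'm \<Rightarrow> 'm tangent_vector"
    and T p :: real
    and \<omega> :: "real \<Rightarrow> real \<Rightarrow> real"
    and x :: "real \<Rightarrow> real^'k"
    and \<X> :: "real \<Rightarrow> real \<Rightarrow> real^'k^'k"
    and y0 :: 'm
  assumes "0 < T" and "1 \<le> p" and "p < 3"
    and "control T \<omega>"
    and "weak_geometric_rough_path T p \<omega> x \<X>"
    and "smooth_manifold M A"
    and "linear_into_fields M A F"
    and "y0 \<in> topspace M"
  shows "\<exists>\<tau> y y'. 0 < \<tau> \<and> \<tau> \<le> T \<and>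
           rde_solution M A F T p \<omega> x \<X> {0..\<tau>} y y' \<and> y 0 = y0"
proof -
  obtain B0 :: "'e set" where "finite B0" "span B0 = UNIV"
    using \<open>smooth_manifold M A\<close> by (auto simp: smooth_manifold_def)
  then obtain B and c :: "'e \<Rightarrow> 'e \<Rightarrow> real" where "finite_coordinates B c"
    using finite_coordinates_exist by blast
  then interpret finite_coordinates B c .
  have chart: "is_chart M c" if "c \<in> A" for c
    using \<open>smooth_manifold M A\<close> that by (auto simp: smooth_manifold_def)
  have "(\<Union>(U, \<phi>)\<in>A. U) = topspace M" using \<open>smooth_manifold M A\<close> by (simp add: smooth_manifold_def)
  then obtain U \<phi> where U: "(U, \<phi>) \<in> A" and y0: "y0 \<in> U" using \<open>y0 \<in> topspace M\<close> by blast
  note cf = chart_facts[OF chart[OF U]]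
  obtain \<xi> :: "'k \<Rightarrow> 'e \<Rightarrow> 'e" where \<xi>: "\<And>i. smooth_on (\<phi> ` U) (\<xi> i)"
    and F_eq: "\<And>q f w. q \<in> U \<Longrightarrow> f \<in> smooth_functions A \<Longrightarrow>
      F w q f = chart_vector (U, \<phi>) q (\<Sum>i\<in>UNIV. w $ i *\<^sub>R \<xi> i (\<phi> q)) f"
    using field_coordinates[OF \<open>linear_into_fields M A F\<close> U chart[OF U]] by blast
  obtain r where r: "0 < r" and K_sub: "cball (\<phi> y0) r \<subseteq> \<phi> ` U"
    using cf(2) y0 by (meson imageI open_contains_cball)
  note K = compact_cball_finite_dim[of "\<phi> y0" r] convex_cball[of "\<phi> y0" r] K_sub
  define \<psi> where "\<psi> i j z = frechet_derivative (\<xi> j) (at z) (\<xi> i z)" for i j z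
  have "\<exists>M'. euler_fields (cball (\<phi> y0) r) \<xi> \<psi> (\<lambda>i z. frechet_derivative (\<xi> i) (at z)) M'"
    unfolding \<psi>_def[abs_def] by (rule euler_fields_exist[OF cf(2) _ K]) (rule \<xi>)
  then obtain M' where "euler_fields (cball (\<phi> y0) r) \<xi> \<psi> (\<lambda>i z. frechet_derivative (\<xi> i) (at z)) M'"
    by (rule exE)
  then interpret E: euler_fields "cball (\<phi> y0) r" \<xi> \<psi> "\<lambda>i z. frechet_derivative (\<xi> i) (at z)" M'
    .
  \<comment> \<open>\<open>p < 3\<close> makes \<open>q\<close> less than 1; \<open>L\<close> below
    is the solution of 2 C + q L = L.\<close>
  define q :: real where "q = 2 powr (1 - 3 / p)"
  have q: "q < 1" unfolding q_def using assms(2,3) powr_less_cancel_iff[of 2 "1 - 3 / p" 0] by simp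
  define L where "L = 2 * E.C / (1 - q)"
  have L: "0 \<le> L" "2 * E.C + q * L \<le> L"
    using q E.C_nonneg by (auto simp: L_def field_simps)
  \<comment> \<open>One bound for each smallness condition of \<open>rough_euler\<close>; the added
    \<open>1\<close> keeps the denominators positive.\<close>
  define \<epsilon> where "\<epsilon> = min 1 (min (1 / (L + 1)) (r / (E.G + L + 1)))"
  have "0 < \<epsilon>" using L E.G_nonneg r by (auto simp: \<epsilon>_def)
  then obtain \<tau> where \<tau>: "0 < \<tau>" "\<tau> \<le> T" "\<omega> 0 \<tau> powr (1 / p) \<le> \<epsilon>"
    using control_small[OF \<open>0 < T\<close> \<open>control T \<omega>\<close>, of \<epsilon> p] assms(2) by auto
  have "\<omega> 0 \<tau> powr (1 / p) \<le> 1 / (L + 1)" "\<omega> 0 \<tau> powr (1 / p) \<le> r / (E.G + L + 1)"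
    using \<tau>(3) by (auto simp: \<epsilon>_def)
  then have "(L + 1) * \<omega> 0 \<tau> powr (1 / p) \<le> 1" "(E.G + L + 1) * \<omega> 0 \<tau> powr (1 / p) \<le> r"
    using L E.G_nonneg by (auto simp: field_simps)
  moreover have "0 \<le> \<omega> 0 \<tau> powr (1 / p)" by simp
  ultimately have small: "L * \<omega> 0 \<tau> powr (1 / p) \<le> 1" "(E.G + L) * \<omega> 0 \<tau> powr (1 / p) \<le> r"
    unfolding distrib_right mult_1 by linarith+
  interpret R: rough_euler "\<phi> y0" r \<xi> \<psi> "\<lambda>i z. frechet_derivative (\<xi> i) (at z)" M' T p \<tau> \<omega> x \<X> L
    using assms(2-5) \<tau> L small by unfold_locales (auto simp: q_def \<epsilon>_def)
  have cont_\<xi>: "continuous_on (cball (\<phi> y0) r) (\<xi> i)" for i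
    using K_sub by (rule continuous_on_subset[OF smooth_on_continuous_on[OF \<xi>]])
  have "smooth_on (\<phi> ` U) (\<psi> i j)" for i j
    unfolding \<psi>_def by (intro smooth_on_derivative_along cf \<xi>)
  then have cont_\<psi>: "continuous_on (cball (\<phi> y0) r) (\<psi> i j)" for i j
    using K_sub by (rule continuous_on_subset[OF smooth_on_continuous_on])
  obtain z where z0: "z 0 = \<phi> y0" and z_in: "\<And>s. z s \<in> cball (\<phi> y0) r"
    and z: "\<And>s t. 0 \<le> s \<Longrightarrow> s \<le> t \<Longrightarrow> t \<le> \<tau> \<Longrightarrow>
      norm (z t - z s - R.incr (z s) s t) \<le> L * \<omega> s t powr (3 / p)"
    using R.approximation_limit[OF K(1) cont_\<xi> cont_\<psi>] by metis
  have z_S: "z s \<in> \<phi> ` U" for s using z_in K_sub by auto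
  have z_cont: "continuous_on {0..\<tau>} z"
    using R.increment_bound[OF z_in _ _ _ z] assms(2)
    by (intro continuous_on_if_control_bound[OF \<open>control T \<omega>\<close> \<tau>(2)]) auto
  \<comment> \<open>\<open>z\<close> is in the ball at every real time, so its lift through the
    chart stays in \<open>U\<close> throughout.\<close>
  define y where "y = inv_into U \<phi> \<circ> z"
  have y_U: "y s \<in> U" and \<phi>_y: "\<phi> (y s) = z s" for s
    using z_S[of s] by (auto simp: y_def inv_into_into f_inv_into_f)
  have y_M: "y s \<in> topspace M" for s using y_U[of s] openin_subset[OF cf(1)] by auto
  have y_cont: "continuous_map (top_of_set {0..\<tau>}) M y"
    unfolding y_def using z_cont z_S
    by (intro continuous_map_compose[OF _ cf(5)]) (auto simp: continuous_map_in_subtopology)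
  have expansion: "\<exists>C \<delta>. 0 < \<delta> \<and> (\<forall>s t. a \<le> s \<and> s \<le> t \<and> t \<le> b \<and> t - s \<le> \<delta> \<longrightarrow>
      \<bar>f (y t) - f (y s) - apply_field (F (x t - x s)) f (y s)
        - contract (\<lambda>w w'. apply_field (F w) (apply_field (F w') f) (y s)) (\<X> s t)\<bar>
      \<le> C * \<omega> s t powr (3 / p))"
    if f: "f \<in> smooth_functions A" and ab: "{a..b} \<subseteq> {0..\<tau>}" for f a b
  proof -
    define g where "g = f \<circ> inv_into U \<phi>"
    have g: "smooth_on (\<phi> ` U) g" unfolding g_def by (rule smooth_functions_chart[OF f U])
    \<comment> \<open>A common constant for the Taylor estimate: \<open>E.G\<close> dominates the
      sizes of \<open>V\<close> and \<open>P\<close>, \<open>L\<close> the error of the Euler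
      step.\<close>
    have "0 \<le> E.G + L" using L E.G_nonneg by simp
    then obtain C where C: "\<And>a b V P \<rho>. a \<in> cball (\<phi> y0) r \<Longrightarrow> b \<in> cball (\<phi> y0) r \<Longrightarrow>
      0 \<le> \<rho> \<Longrightarrow> \<rho> \<le> 1 \<Longrightarrow> norm V \<le> (E.G + L) * \<rho> \<Longrightarrow>
      norm P \<le> (E.G + L) * \<rho>\<^sup>2 \<Longrightarrow> norm (b - a - V - P) \<le> (E.G + L) * \<rho>^3 \<Longrightarrow>
      \<bar>g b - g a - frechet_derivative g (at a) V -
        ((1/2) * second_derivative g a V V + frechet_derivative g (at a) P)\<bar> \<le> C * \<rho>^3"
      using rough_taylor_bound[OF cf(2) g K] by metis
    have "\<bar>f (y t) - f (y s) - apply_field (F (x t - x s)) f (y s)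
        - contract (\<lambda>w w'. apply_field (F w) (apply_field (F w') f) (y s)) (\<X> s t)\<bar>
      \<le> C * \<omega> s t powr (3 / p)" if st: "a \<le> s" "s \<le> t" "t \<le> b" for s t
    proof -
      have st': "0 \<le> s" "t \<le> \<tau>" "t \<le> T" using st ab \<tau>(2) by auto
      define V where "V = (\<Sum>i\<in>UNIV. (x t - x s) $ i *\<^sub>R \<xi> i (z s))"
      define P where "P = (\<Sum>i\<in>UNIV. \<Sum>j\<in>UNIV. \<X> s t $ i $ j *\<^sub>R \<psi> i j (z s))"
      let ?\<rho> = "\<omega> s t powr (1 / p)"
      have \<rho>: "0 \<le> ?\<rho>" "?\<rho> \<le> 1" using R.root_control_mono[of 0 s t \<tau>] R.small(1) st st' by auto
      have NM: "real CARD('k) * M' \<le> E.G + L" "(real CARD('k))\<^sup>2 * M' \<le> E.G + L"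
        using L(1) E.M_nonneg by (auto simp: E.G_def)
      note bounds = rough_path_bounds[OF \<open>weak_geometric_rough_path T p \<omega> x \<X>\<close> st'(1) st(2) st'(3)]
      have "norm V \<le> real CARD('k) * (?\<rho> * M')"
        unfolding V_def using bounds(1) E.\<xi>_bound[OF z_in] by (rule norm_vec_combination_le)
      also have "\<dots> \<le> (E.G + L) * ?\<rho>"
        using mult_right_mono[OF NM(1) \<rho>(1)] by (simp add: mult_ac)
      finally have V: "norm V \<le> (E.G + L) * ?\<rho>" .
      have "norm P \<le> (real CARD('k))\<^sup>2 * (?\<rho>\<^sup>2 * M')"
        unfolding P_def using bounds(2) E.\<psi>_bound[OF z_in] by (rule norm_matrix_combination_le)
      also have "\<dots> \<le> (E.G + L) * ?\<rho>\<^sup>2"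
        using mult_right_mono[OF NM(2) zero_le_power2[of ?\<rho>]] by (simp add: mult_ac)
      finally have P: "norm P \<le> (E.G + L) * ?\<rho>\<^sup>2" .
      have "norm (z t - z s - V - P) \<le> L * ?\<rho>^3"
        using z[OF st'(1) st(2) st'(2)] by (simp add: V_def P_def euler_increment_def R.powr_3_over_p diff_diff_eq add.assoc)
      also have "\<dots> \<le> (E.G + L) * ?\<rho>^3" using E.G_nonneg by (intro mult_right_mono) auto
      finally have J: "norm (z t - z s - V - P) \<le> (E.G + L) * ?\<rho>^3" .
      have f_y: "f (y s') = g (z s')" for s' by (simp add: g_def y_def)
      have first: "apply_field (F (x t - x s)) f (y s) = frechet_derivative g (at (z s)) V"
        by (simp add: apply_field_def F_eq[OF y_U f] chart_vector_def \<phi>_y g_def V_def)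
      have "apply_field (F (axis i 1)) (apply_field (F (axis j 1)) f) (y s) =
          frechet_derivative (\<lambda>z. frechet_derivative g (at z) (\<xi> j z)) (at (z s)) (\<xi> i (z s))" for i j
      proof -
        have h: "apply_field (F (axis j 1)) f \<in> smooth_functions A"
          by (rule apply_field_smooth[OF \<open>linear_into_fields M A F\<close> chart f])
        \<comment> \<open>The coordinate formula is known on the chart image; since that is open,
          equality there passes to derivatives.\<close>
        have eq: "frechet_derivative g (at z') (\<xi> j z') = (apply_field (F (axis j 1)) f \<circ> inv_into U \<phi>) z'"
          if "z' \<in> \<phi> ` U" for z'
          using that cf(3) by (auto simp: apply_field_def F_eq[OF _ f] chart_vector_def axis_combination g_def)
        have "(\<lambda>z. frechet_derivative g (at z) (\<xi> j z)) differentiable (at (z s))"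
          by (rule differentiableI[OF smooth_on_has_derivative[OF
                smooth_on_derivative_along[OF cf(2) g \<xi>[of j]] z_S[of s]]])
        then have "frechet_derivative (\<lambda>z. frechet_derivative g (at z) (\<xi> j z)) (at (z s)) =
            frechet_derivative (apply_field (F (axis j 1)) f \<circ> inv_into U \<phi>) (at (z s))"
          by (rule frechet_derivative_transform_within_open[OF _ cf(2) z_S]) (rule eq)
        then show ?thesis
          by (simp add: apply_field_def[of "F (axis i 1)"] F_eq[OF y_U h] chart_vector_def axis_combination \<phi>_y)
      qed
      moreover have "\<X> s t + transpose (\<X> s t) = tensor (x t - x s) (x t - x s)"
        using assms(5) st st' by (auto simp: weak_geometric_rough_path_def)
      ultimately have second: "contract (\<lambda>w w'. apply_field (F w) (apply_field (F w') f) (y s)) (\<X> s t) =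
          (1/2) * second_derivative g (z s) V V + frechet_derivative g (at (z s)) P"
        unfolding contract_def V_def P_def \<psi>_def
        using second_order_term[where \<xi> = \<xi>, OF cf(2) z_S g \<xi>] by simp
      show ?thesis
        using C[OF z_in z_in \<rho> V P J] unfolding f_y first second R.powr_3_over_p .
    qed
    \<comment> \<open>The bound was obtained for every pair in \<open>{a..b}\<close>, so
      \<open>1\<close> is an admissible value of \<delta>.\<close>
    then show ?thesis by (intro exI[of _ C] exI[of _ 1]) auto
  qed
  \<comment> \<open>The second component is dictated by the equation: it is \<open>F\<close> along
    \<open>y\<close>.\<close>
  have "rde_solution M A F T p \<omega> x \<X> {0..\<tau>} y (\<lambda>s w. F w (y s))"
    unfolding rde_solution_def
  proof (intro conjI ballI allI impI)
    show "\<exists>T0. 0 \<le> T0 \<and> T0 \<le> T \<and> ({0..\<tau>} = {0..T0} \<or> {0..\<tau>} = {0..<T0})"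
      using \<tau> by (intro exI[of _ \<tau>]) auto
    show "(\<lambda>w. F w (y s)) \<in> linear_maps_tangent A (y s)" for s
      using \<open>linear_into_fields M A F\<close> y_M[of s]
      by (auto simp: linear_maps_tangent_def linear_into_fields_def smooth_vector_fields_def)
    show "continuous_along A {0..\<tau>} y (\<lambda>s w. F w (y s))"
      by (rule continuous_along_fields[OF \<open>linear_into_fields M A F\<close> chart y_cont])
  qed (use y_cont expansion in auto)
  moreover have "y 0 = y0" using y0 cf(3) by (simp add: y_def z0 inv_into_f_f)
  ultimately show ?thesis using \<tau> by blast
qed

end
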